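(* Let $f\colon\mathbb{R}\to\mathbb{R}$ be an extendable function whose graph is dense in $\mathbb{R}^2$. Then for every $a,b\in\mathbb{R}$ with $a<b$ and for each Cantor set $K$ between $f(a)$ and $f(b)$ there is a Cantor set $C$ between $a$ and $b$ such that $f[C]\subset K$ and the restriction $f\restriction C$ is continuous and strictly increasing.
   Context: A Cantor set is any nonempty perfect nowhere dense subset of $\mathbb{R}$. A set is "between" two reals $p,q$ if it is contained in the open interval with endpoints $p$ and $q$ (empty if $p=q$). For a topological space $X$, a function $F\colon X\to\mathbb{R}$ is a connectivity function if for every connected $Z\subset X$ the graph of $F\restriction Z$ is connected in $Z\times\mathbb{R}$. A function $f\colon\mathbb{R}\to\mathbb{R}$ is extendable (an extendability function) if there exists a connectivity function $F\colon\mathbb{R}\times[0,1]\to\mathbb{R}$ such that $f(x)=F(x,0)$ for every $x\in\mathbb{R}$. *)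

theory Defs
  imports "HOL-Analysis.Analysis"
begin

definition graph_on :: "'a set \<Rightarrow> ('a \<Rightarrow> 'b) \<Rightarrow> ('a \<times> 'b) set" where
  "graph_on Z F = (\<lambda>z. (z, F z)) ` Z"

definition perfect :: "'a::topological_space set \<Rightarrow> bool" where
  "perfect S \<longleftrightarrow> closed S \<and> (\<forall>x\<in>S. x islimpt S)"

definition nowhere_dense :: "'a::topological_space set \<Rightarrow> bool" where
  "nowhere_dense S \<longleftrightarrow> interior (closure S) = {}"

definition cantor_set :: "real set \<Rightarrow> bool" where
  "cantor_set C \<longleftrightarrow> C \<noteq> {} \<and> perfect C \<and> nowhere_dense C"

text \<open>The endpoints need not be ordered; \<^term>\<open>open_segment p p\<close> is empty.\<close>

definition between_points :: "real set \<Rightarrow> real \<Rightarrow> real \<Rightarrow> bool" where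
  "between_points S p q \<longleftrightarrow> S \<subseteq> open_segment p q"

text \<open>The space \<open>X\<close> is a subspace of the ambient type, and a function from \<open>X\<close> to the
  reals is a total function whose values outside \<open>X\<close> are irrelevant.\<close>

definition connectivity_on :: "'a::topological_space set \<Rightarrow> ('a \<Rightarrow> real) \<Rightarrow> bool" where
  "connectivity_on X F \<longleftrightarrow> (\<forall>Z\<subseteq>X. connected Z \<longrightarrow> connected (graph_on Z F))"

definition extendable :: "(real \<Rightarrow> real) \<Rightarrow> bool" where
  "extendable f \<longleftrightarrow>
    (\<exists>F :: real \<times> real \<Rightarrow> real. connectivity_on (UNIV \<times> {0..1}) F \<and> (\<forall>x. f x = F (x, 0)))"

end

theory Submission
  imports Defs
begin

text \<open>Let \<open>F\<close> be a connectivity function on the strip \<open>X = UNIV \<times> {0..1}\<close> that extends \<open>f\<close>. Since the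
  graph of \<open>f\<close> is dense, one may shrink \<open>{a<..<b}\<close> so that \<open>K\<close> lies between \<open>f a\<close> below and \<open>f b\<close> above.
  Put \<open>p = (a, 0)\<close> and \<open>q = (b, 0)\<close>.

  The values of \<open>F\<close> are rigid along large connected sets. Suppose that connected sets, none of
  them inside a neighbourhood \<open>N\<close> of \<open>z\<close> with connected complement, accumulate at \<open>z\<close>. Their union with
  \<open>X - N\<close> and \<open>z\<close> is connected, and near \<open>z\<close> it consists of these sets only. So the value at \<open>z\<close> is a
  limit of values on them (\<open>connectivity_limit_family\<close>). This is used twice.

  First, level sets of \<open>F\<close> need not be closed, but they contain the limits of those of their
  components that do not shrink. For \<open>y\<close> between \<open>F p\<close> and \<open>F q\<close> the level set meets every connected
  set joining \<open>p\<close> to \<open>q\<close>, and, as for closed sets, it follows that one of its components separates \<open>p\<close>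
  from \<open>q\<close> (\<open>loosely_closed_separation_by_component\<close>). The idea: fill every component with what it cuts
  off. If no component separates, the complement of all fillings turns out to be connected, and it
  contains \<open>p\<close> and \<open>q\<close> but no point of the level set.

  Second, if each point of a set \<open>B\<close> on the bottom edge lies on a separator at the level of its value,
  then \<open>f\<close> is continuous on the closure of \<open>B\<close>, away from \<open>p\<close> and \<open>q\<close>.

  It remains to choose the separators so that \<open>f\<close> increases. Between two separators there is one at
  every intermediate level, so there is a densely ordered chain of separators whose levels increase
  in \<open>K\<close>. The path along the bottom edge from \<open>p\<close> must cross the earlier separator before it first
  reaches the later one, so the first points of the separators on the edge are in the same order.
  A perfect set of points that are approximated from both sides by first points
  (\<open>two_sided_perfect_set\<close>) is the required Cantor set.\<close>

section \<open>Separation in convex sets\<close>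

text \<open>Working with connected sets instead of components lets \<open>A\<close> and \<open>B\<close> be arbitrary sets and
  leaves it open whether they meet \<open>S\<close>.\<close>

definition separates ::
    "'a::topological_space set \<Rightarrow> 'a set \<Rightarrow> 'a set \<Rightarrow> 'a set \<Rightarrow> bool" where
  "separates X S A B \<longleftrightarrow>
    (\<forall>W\<subseteq>X. connected W \<and> W \<inter> A \<noteq> {} \<and> W \<inter> B \<noteq> {} \<longrightarrow> W \<inter> S \<noteq> {})"

lemma separatesD:
  "\<lbrakk>separates X S A B; W \<subseteq> X; connected W; x \<in> W; x \<in> A; y \<in> W; y \<in> B\<rbrakk> \<Longrightarrow> \<exists>s. s \<in> W \<and> s \<in> S"
  unfolding separates_def by blast

lemma separates_points_iff:
  "separates X S {p} {q} \<longleftrightarrow> \<not> connected_component (X - S) p q"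
  unfolding separates_def connected_component_def by blast

lemma openin_component_diff:
  fixes X :: "'a::real_normed_vector set"
  assumes "convex X" "closed S" "x \<in> X - S"
  shows "openin (top_of_set X) (connected_component_set (X - S) x)"
proof -
  have "openin (top_of_set X) (X - S)"
    using assms(2) by (simp add: Diff_eq openin_open_Int open_Compl)
  then show ?thesis
    using convex_imp_locally_connected[OF assms(1)] assms(3) locally_connected_2 by blast
qed

text \<open>Components are relatively closed, so a point in the closure of a component of \<open>S\<close> is either in
  that component or not in \<open>S\<close> at all.\<close>

lemma closure_component_diff:
  assumes "z \<in> closure (connected_component_set S x)" "z \<in> S"
  shows "z \<in> connected_component_set S x"
  using closedin_connected_component[of S x] assms
  by (metis (no_types, lifting) IntI closedin_closed closure_minimal inf_le2 subsetD)

text \<open>A convex set is unicoherent. Let \<open>A\<close> be the closure of the component of \<open>X - S\<close> that contains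
  \<open>p\<close>, and \<open>U\<close> the component of \<open>X - A\<close> that contains \<open>q\<close>. Then \<open>closure U\<close> and \<open>X - U\<close> are
  connected closed sets that cover \<open>X\<close>, so their intersection, the boundary of \<open>U\<close>, is connected;
  it lies in \<open>S\<close> and separates.\<close>

lemma separation_by_connected_subset:
  fixes X :: "'a::euclidean_space set"
  assumes cX: "convex X" and clX: "closed X" and clS: "closed S" and "S \<subseteq> X"
    and p: "p \<in> X - S" and q: "q \<in> X - S" and sep: "separates X S {p} {q}"
  obtains T where "T \<subseteq> S" "closed T" "connected T" "separates X T {p} {q}"
proof -
  define P where "P = connected_component_set (X - S) p"
  define A where "A = closure P"
  have opP: "openin (top_of_set X) P"
    unfolding P_def using openin_component_diff[OF cX clS p] .
  have conP: "connected P" unfolding P_def by simp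
  have PX: "P \<subseteq> X - S" unfolding P_def by (rule connected_component_subset)
  have pP: "p \<in> P" unfolding P_def using p by simp
  have AX: "A \<subseteq> X" unfolding A_def using PX clX by (meson Diff_subset closure_minimal order_trans)
  have conA: "connected A" unfolding A_def using conP by (rule connected_imp_connected_closure)
  have clA: "closed A" unfolding A_def by simp
  \<comment> \<open>off \<open>S\<close> the set \<open>A\<close> has no points beyond \<open>P\<close> itself\<close>
  have AP: "z \<in> P" if "z \<in> A" "z \<notin> S" for z
    using that AX closure_component_diff[of z "X - S" p] unfolding A_def P_def by blast
  have qP: "q \<notin> P"
    using sep unfolding P_def separates_points_iff by simp
  then have qA: "q \<in> X - A" using AP q by blast
  define U where "U = connected_component_set (X - A) q"
  have opU: "openin (top_of_set X) U"
    unfolding U_def using openin_component_diff[OF cX clA qA] .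
  have conU: "connected U" unfolding U_def by simp
  have UX: "U \<subseteq> X - A" unfolding U_def by (rule connected_component_subset)
  have qU: "q \<in> U" unfolding U_def using qA by simp
  have "U \<in> components (X - A)" unfolding U_def using qA by (rule componentsI)
  then have conXU: "connected (X - U)"
    using component_diff_connected[of A X U] conA AX convex_connected[OF cX] by blast
  obtain O2 where O2: "open O2" "U = X \<inter> O2" using opU by (auto simp: openin_open)
  have clXU: "closed (X - U)"
    using O2 clX by (metis Diff_Int_distrib2 Diff_cancel Un_empty_left Diff_Int closed_Diff)
  define T where "T = closure U \<inter> (X - U)"
  have cUX: "closure U \<subseteq> X" using UX clX by (meson Diff_subset closure_minimal order_trans)
  have "connected T"
    unfolding T_def
  proof (rule unicoherentD[OF convex_imp_unicoherent[OF cX]])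
    show "connected (closure U)" using conU by (rule connected_imp_connected_closure)
    show "X = closure U \<union> (X - U)" using cUX closure_subset by fastforce
    show "closedin (top_of_set X) (closure U)" using cUX by (simp add: closed_subset)
    show "closedin (top_of_set X) (X - U)" using clXU by (simp add: closed_subset)
  qed (use conXU in auto)
  moreover have "closed T" unfolding T_def using clXU by auto
  moreover have "T \<subseteq> S"
  proof
    fix z assume z: "z \<in> T"
    then have zX: "z \<in> X" "z \<in> closure U" "z \<notin> U" by (auto simp: T_def)
    have "z \<in> A"
      using zX closure_component_diff[of z "X - A" q] unfolding U_def by blast
    show "z \<in> S"
    proof (rule ccontr)
      assume "z \<notin> S"
      with AP \<open>z \<in> A\<close> have "z \<in> P" by blast
      obtain O1 where "open O1" "P = X \<inter> O1" using opP by (auto simp: openin_open)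
      with zX \<open>z \<in> P\<close> obtain w where "w \<in> U" "w \<in> O1"
        by (metis IntD2 disjoint_iff open_Int_closure_eq_empty)
      then have "w \<in> P" using UX \<open>P = X \<inter> O1\<close> by blast
      then show False using \<open>w \<in> U\<close> UX closure_subset unfolding A_def by blast
    qed
  qed
  moreover have "separates X T {p} {q}"
    unfolding separates_def
  proof (intro allI impI notI, elim conjE)
    fix W assume W: "W \<subseteq> X" "connected W" "W \<inter> {p} \<noteq> {}" "W \<inter> {q} \<noteq> {}" "W \<inter> T = {}"
    have pcU: "p \<notin> closure U"
    proof
      assume "p \<in> closure U"
      moreover have "p \<notin> U" using UX pP closure_subset unfolding A_def by blast
      ultimately have "p \<in> T" unfolding T_def using p by blast
      then show False using \<open>T \<subseteq> S\<close> p by blast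
    qed
    have "O2 \<inter> W = {} \<or> (- closure U) \<inter> W = {}"
    proof (rule connectedD[OF W(2)])
      show "open O2" using O2 by simp
      show "open (- closure U)" by (simp add: open_Compl)
      have "O2 \<inter> W \<subseteq> U" using O2 W(1) by blast
      then show "O2 \<inter> - closure U \<inter> W = {}" using closure_subset[of U] by blast
      show "W \<subseteq> O2 \<union> - closure U" using W(1,5) O2 unfolding T_def by blast
    qed
    then show False using W(3,4) pcU qU O2 by blast
  qed
  ultimately show ?thesis using that by blast
qed

lemma separates_connected_supersets:
  assumes "separates X C {a} {b}" and "a \<in> A" "b \<in> B" "connected A" "connected B"
    and "A \<subseteq> X" "B \<subseteq> X" "A \<inter> C = {}" "B \<inter> C = {}"
  shows "separates X C A B"
  unfolding separates_def
proof (intro allI impI, elim conjE)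
  fix W assume W: "W \<subseteq> X" "connected W" "W \<inter> A \<noteq> {}" "W \<inter> B \<noteq> {}"
  have "connected (A \<union> W)" using assms W by (intro connected_Un) auto
  then have "connected (A \<union> W \<union> B)" using assms W by (intro connected_Un) auto
  then have "\<exists>s. s \<in> A \<union> W \<union> B \<and> s \<in> C"
    using separatesD[OF assms(1), of "A \<union> W \<union> B" a b] assms W by blast
  then show "W \<inter> C \<noteq> {}" using assms by blast
qed

lemma separates_trans:
  assumes "separates X Z A Z'" "separates X Z' A Z''"
  shows "separates X Z A Z''"
  unfolding separates_def
proof (intro allI impI, elim conjE)
  fix W assume W: "W \<subseteq> X" "connected W" "W \<inter> A \<noteq> {}" "W \<inter> Z'' \<noteq> {}"
  then have "W \<inter> Z' \<noteq> {}" using assms(2) unfolding separates_def by simp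
  then show "W \<inter> Z \<noteq> {}" using assms(1) W unfolding separates_def by simp
qed

text \<open>If a connected set from \<open>p\<close> reached \<open>C\<close> before \<open>Z\<close>, then \<open>C\<close> would lie in the component of \<open>X - Z\<close>
  that contains \<open>p\<close>. The complement of that component is connected and contains \<open>Z\<close> and \<open>z\<close>, so it
  would join \<open>Z\<close> to \<open>Z'\<close> off \<open>C\<close>.\<close>

lemma separates_between:
  fixes X :: "'a::metric_space set"
  assumes X: "connected X" and Z: "Z \<subseteq> X" "connected Z" and C: "C \<subseteq> X" "connected C" "Z \<inter> C = {}"
    and Z': "z \<in> Z'" "z \<in> X" "z \<notin> Z" "Z \<noteq> {}" and p: "p \<in> X"
    and sep: "separates X Z {p} Z'" "separates X C Z Z'"
  shows "separates X Z {p} C" "separates X C {p} Z'"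
proof -
  show "separates X C {p} Z'"
    unfolding separates_def
  proof (intro allI impI, elim conjE)
    fix W assume W: "W \<subseteq> X" "connected W" "W \<inter> {p} \<noteq> {}" "W \<inter> Z' \<noteq> {}"
    then have "W \<inter> Z \<noteq> {}" using sep(1) unfolding separates_def by simp
    then show "W \<inter> C \<noteq> {}" using sep(2) W unfolding separates_def by simp
  qed
  show "separates X Z {p} C"
    unfolding separates_def
  proof (intro allI impI notI, elim conjE)
    fix W assume W: "W \<subseteq> X" "connected W" "W \<inter> {p} \<noteq> {}" "W \<inter> C \<noteq> {}" "W \<inter> Z = {}"
    define V where "V = connected_component_set (X - Z) p"
    have pXZ: "p \<in> X - Z" using p W by blast
    have "connected (W \<union> C)" using W C by (intro connected_Un) auto
    then have CV: "C \<subseteq> V"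
      using connected_component_maximal[of p "W \<union> C" "X - Z"] W C unfolding V_def by blast
    have "V \<in> components (X - Z)" unfolding V_def using pXZ by (rule componentsI)
    then have con: "connected (X - V)" using component_diff_connected[OF Z(2) X Z(1)] by blast
    have VZ: "V \<subseteq> X - Z" unfolding V_def by (rule connected_component_subset)
    have "connected V" "p \<in> V" unfolding V_def using pXZ by simp_all
    then have "z \<notin> V"
      using separatesD[OF sep(1), of V p z] VZ Z'(1) by blast
    then have "\<exists>s. s \<in> X - V \<and> s \<in> C"
      using separatesD[OF sep(2) _ con, of _ z] VZ Z Z' by blast
    then show False using CV by blast
  qed
qed

section \<open>Separation by one component\<close>

text \<open>Every point has arbitrarily small neighbourhoods that do not disconnect the space. An interval does
  not have this property, the strip has; it is where dimension two enters.\<close>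

definition small_cuts :: "'a::metric_space set \<Rightarrow> bool" where
  "small_cuts X \<longleftrightarrow>
    (\<forall>z\<in>X. \<forall>e>0. \<exists>N. open N \<and> z \<in> N \<and> N \<subseteq> ball z e \<and> connected (X - N))"

text \<open>The substitute for closedness that level sets of connectivity functions enjoy: limits of
  components of \<open>M\<close> belong to \<open>M\<close>, as long as the components do not shrink to a point. The size
  condition is phrased as not fitting into a neighbourhood \<open>N\<close> with connected complement.\<close>

definition loosely_closed :: "'a::metric_space set \<Rightarrow> 'a set \<Rightarrow> bool" where
  "loosely_closed X M \<longleftrightarrow>
    M \<subseteq> X \<and> (\<forall>C\<in>components M. closed C) \<and>
    (\<forall>L z N. L \<subseteq> components M \<and> z \<in> X \<and> z \<in> closure (\<Union>L) \<and>
       open N \<and> z \<in> N \<and> connected (X - N) \<and> (\<forall>C\<in>L. \<not> C \<subseteq> N) \<longrightarrow> z \<in> M)"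

text \<open>The situation to be refuted when \<open>M\<close> separates \<open>p\<close> from \<open>q\<close>: no single component does.\<close>

locale non_separating_components =
  fixes X M :: "'a::euclidean_space set" and p q :: 'a
  assumes convX: "convex X" and closX: "closed X" and cutsX: "small_cuts X"
    and loose: "loosely_closed X M"
    and pX: "p \<in> X - M" and qX: "q \<in> X - M" and pq: "p \<noteq> q"
    and joined: "\<And>C. C \<in> components M \<Longrightarrow> connected_component (X - C) p q"
begin

definition outer :: "'a set \<Rightarrow> 'a set" where
  "outer C = connected_component_set (X - C) p"

text \<open>\<open>C\<close> together with everything that it cuts off from \<open>p\<close>. Since \<open>C\<close> does not separate \<open>p\<close> from
  \<open>q\<close>, it is the same to say: from \<open>q\<close>.\<close>

definition filled :: "'a set \<Rightarrow> 'a set" where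
  "filled C = X - outer C"

lemma MX: "M \<subseteq> X"
  using loose unfolding loosely_closed_def by blast

lemma component:
  assumes "C \<in> components M"
  shows "closed C" "connected C" "C \<noteq> {}" "C \<subseteq> M" "C \<subseteq> X" "p \<in> X - C" "q \<in> X - C"
proof -
  show "closed C" using assms loose unfolding loosely_closed_def by blast
  show "connected C" "C \<noteq> {}" and CM: "C \<subseteq> M"
    using in_components_connected[OF assms] in_components_nonempty[OF assms]
      in_components_subset[OF assms] by auto
  show "C \<subseteq> X" "p \<in> X - C" "q \<in> X - C" using CM MX pX qX by auto
qed

lemma outer:
  assumes "C \<in> components M"
  shows "connected (outer C)" "outer C \<subseteq> X - C" "p \<in> outer C" "q \<in> outer C"
    "openin (top_of_set X) (outer C)"
  using component[OF assms] joined[OF assms] connected_component_subset[of "X - C" p]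
    openin_component_diff[OF convX component(1)[OF assms] component(6)[OF assms]]
  unfolding outer_def by simp_all

lemma outer_maximal:
  assumes "C \<in> components M" "connected W" "W \<subseteq> X - C" "w \<in> W" "w \<in> outer C"
  shows "W \<subseteq> outer C"
  using assms connected_component_maximal[of w W "X - C"] connected_component_eq[of w "X - C" p]
  unfolding outer_def by blast

lemma filled_subset: "filled C \<subseteq> X" unfolding filled_def by blast

lemma subset_filled: "C \<in> components M \<Longrightarrow> C \<subseteq> filled C"
  using outer(2) component(5) unfolding filled_def by blast

lemma filled_boundary:
  assumes "C \<in> components M" "connected W" "W \<subseteq> X" "x \<in> W" "x \<in> filled C" "y \<in> W" "y \<notin> filled C"
  shows "W \<inter> C \<noteq> {}"
  using outer_maximal[OF assms(1,2), of y] assms unfolding filled_def by blast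

lemma connected_filled:
  assumes "C \<in> components M"
  shows "connected (filled C)"
proof -
  have "outer C \<in> components (X - C)"
    using component(6)[OF assms] unfolding outer_def by (rule componentsI)
  then show ?thesis
    using component_diff_connected[of C X "outer C"] component[OF assms] convex_connected[OF convX]
    unfolding filled_def by blast
qed

lemma closed_filled:
  assumes "C \<in> components M"
  shows "closed (filled C)"
  using outer(5)[OF assms] closX unfolding filled_def
  by (metis closedin_closed_trans closedin_def Diff_subset openin_subset topspace_euclidean_subtopology double_diff order_refl)

lemma openin_filled_interior:
  assumes "C \<in> components M"
  shows "openin (top_of_set X) (filled C - C)"
proof (subst openin_subopen, intro ballI)
  fix h assume h: "h \<in> filled C - C"
  let ?Z = "connected_component_set (X - C) h"
  have hX: "h \<in> X - C" using h filled_subset by blast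
  then have "openin (top_of_set X) ?Z"
    using openin_component_diff[OF convX component(1)[OF assms]] by blast
  moreover have "h \<in> ?Z" using hX by simp
  moreover have "?Z \<subseteq> filled C - C"
  proof -
    have "?Z \<inter> outer C = {}"
      using h connected_component_nonoverlap[of "X - C" h p]
      unfolding filled_def outer_def by (metis (no_types, lifting) DiffD1 DiffD2 connected_component_eq_eq hX mem_Collect_eq connected_component_refl disjoint_iff connected_component_trans connected_component_sym)
    then show ?thesis using connected_component_subset[of "X - C" h] unfolding filled_def by blast
  qed
  ultimately show "\<exists>T. openin (top_of_set X) T \<and> h \<in> T \<and> T \<subseteq> filled C - C" by blast
qed

text \<open>Being connected, \<open>C'\<close> cannot leave the filling of \<open>C\<close> without meeting \<open>C\<close>. Hence whatever is joined
  to \<open>p\<close> off \<open>C\<close> is also joined to \<open>p\<close> off \<open>C'\<close>.\<close>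

lemma filled_inside:
  assumes C: "C \<in> components M" and C': "C' \<in> components M" and ne: "C \<noteq> C'"
    and meet: "C' \<inter> filled C \<noteq> {}"
  shows "C' \<subseteq> filled C - C" "filled C' \<subseteq> filled C"
proof -
  have dis: "C \<inter> C' = {}" using components_nonoverlap[OF C C'] ne by blast
  have "C' \<subseteq> filled C"
  proof
    fix y assume "y \<in> C'"
    then show "y \<in> filled C"
      using filled_boundary[OF C component(2,5)[OF C']] meet dis by blast
  qed
  then show C'h: "C' \<subseteq> filled C - C" using dis by blast
  have "outer C \<subseteq> X - C'" using C'h outer(2)[OF C] unfolding filled_def by blast
  then have "outer C \<subseteq> outer C'"
    using outer_maximal[OF C' outer(1)[OF C], of p] outer(3)[OF C] outer(3)[OF C'] by blast
  then show "filled C' \<subseteq> filled C" unfolding filled_def by blast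
qed

lemma filled_nested:
  assumes C: "C \<in> components M" and C': "C' \<in> components M" and ne: "C \<noteq> C'"
    and meet: "C' \<inter> filled C \<noteq> {}"
  shows "filled C' \<subseteq> filled C - C"
proof -
  \<comment> \<open>if each of \<open>C\<close>, \<open>C'\<close> were inside the other, their common filling would be clopen in \<open>X\<close>\<close>
  have "C \<inter> filled C' = {}"
  proof (rule ccontr)
    assume "C \<inter> filled C' \<noteq> {}"
    then have 2: "C \<subseteq> filled C' - C'" "filled C \<subseteq> filled C'"
      using filled_inside[OF C' C] ne by blast+
    have eq: "filled C' = filled C" using filled_inside[OF assms] 2 by blast
    then have eq2: "filled C = (filled C - C) \<union> (filled C' - C')"
      using filled_inside[OF assms] 2 by blast
    have "openin (top_of_set X) (filled C)"
      by (subst eq2, rule openin_Un[OF openin_filled_interior[OF C] openin_filled_interior[OF C']])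
    moreover have "closedin (top_of_set X) (filled C)"
      using closed_filled[OF C] filled_subset closed_subset by blast
    ultimately have "filled C = {} \<or> filled C = X"
      using convex_connected[OF convX] connected_clopen by blast
    then show False using component(3)[OF C] subset_filled[OF C] outer(3)[OF C] pX
      unfolding filled_def by blast
  qed
  then show ?thesis using filled_inside[OF assms] by blast
qed

text \<open>If neither component meets the filling of the other, the fillings are disjoint: the filling of \<open>C\<close>
  is connected and cannot reach into that of \<open>C'\<close> without meeting \<open>C'\<close>.\<close>

lemma filled_cases:
  assumes C: "C \<in> components M" and C': "C' \<in> components M" and ne: "C \<noteq> C'"
  shows "filled C' \<subseteq> filled C - C \<or> filled C \<subseteq> filled C' - C' \<or> filled C \<inter> filled C' = {}"
proof (cases "C' \<inter> filled C = {} \<and> C \<inter> filled C' = {}")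
  case True
  have "filled C \<inter> filled C' = {}"
  proof (rule ccontr)
    assume "filled C \<inter> filled C' \<noteq> {}"
    moreover obtain c where "c \<in> C" using component(3)[OF C] by blast
    ultimately have "filled C \<inter> C' \<noteq> {}"
      using filled_boundary[OF C' connected_filled[OF C] filled_subset, of _ c] True subset_filled[OF C] by blast
    then show False using True by blast
  qed
  then show ?thesis by blast
next
  case False
  then show ?thesis using filled_nested[OF C C' ne] filled_nested[OF C' C] ne by metis
qed

text \<open>A component around \<open>x\<close> is too large for a small neighbourhood \<open>N\<close> away from \<open>x\<close>: otherwise
  \<open>X - N\<close> would join \<open>x\<close> to \<open>p\<close> or to \<open>q\<close> without meeting \<open>C\<close>.\<close>

lemma filled_not_subset_cut:
  assumes C: "C \<in> components M" and x: "x \<in> filled C" and N: "connected (X - N)" "x \<notin> N"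
    and "p \<notin> N \<or> q \<notin> N"
  shows "\<not> C \<subseteq> N"
proof
  assume CN: "C \<subseteq> N"
  obtain w where w: "w \<in> X - N" "w \<in> outer C"
    using assms(5) outer(3,4)[OF C] pX qX by blast
  have "(X - N) \<inter> C \<noteq> {}"
    by (rule filled_boundary[OF C N(1) _ _ x, of w]) (use x N w filled_subset in \<open>auto simp: filled_def\<close>)
  then show False using CN by blast
qed

text \<open>The fillings around \<open>x\<close> form a chain; let \<open>Y\<close> be its union. Without a largest member \<open>Y\<close> is open,
  and every boundary point of \<open>Y\<close> is a limit of components around \<open>x\<close>, hence in \<open>M\<close> by loose
  closedness. The boundary separates \<open>x\<close> from \<open>p\<close>, so a connected part of it does, and the component
  of \<open>M\<close> containing that part goes around \<open>x\<close> although it is not contained in \<open>Y\<close>.\<close>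

lemma maximal_filled_exists:
  assumes C0: "C0 \<in> components M" and x: "x \<in> filled C0"
  obtains C where "C \<in> components M" "x \<in> filled C"
    "\<And>C'. \<lbrakk>C' \<in> components M; x \<in> filled C'\<rbrakk> \<Longrightarrow> filled C' \<subseteq> filled C"
proof -
  have "\<exists>C\<in>components M. x \<in> filled C \<and>
    (\<forall>C'\<in>components M. x \<in> filled C' \<longrightarrow> filled C' \<subseteq> filled C)"
  proof (rule ccontr)
    assume no: "\<not> ?thesis"
    define L where "L = {C \<in> components M. x \<in> filled C}"
    define Y where "Y = (\<Union>C\<in>L. filled C)"
    have xX: "x \<in> X" using x filled_subset by blast
    have xY: "x \<in> Y" using C0 x unfolding Y_def L_def by blast
    have pY: "p \<notin> Y" using outer(3) unfolding Y_def L_def filled_def by blast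
    have YX: "Y \<subseteq> X" unfolding Y_def using filled_subset by blast
    have "\<exists>C'\<in>L. filled C \<subseteq> filled C' - C'" if C: "C \<in> L" for C
    proof -
      have "C \<in> components M" "x \<in> filled C" using C unfolding L_def by auto
      then have "\<not> (\<forall>C'\<in>components M. x \<in> filled C' \<longrightarrow> filled C' \<subseteq> filled C)"
        using no by blast
      then obtain C' where C': "C' \<in> L" "\<not> filled C' \<subseteq> filled C"
        unfolding L_def by blast
      then have "C \<noteq> C'" by blast
      then have "filled C \<subseteq> filled C' - C'"
        using filled_cases[of C C'] C C' unfolding L_def by blast
      then show ?thesis using C' by blast
    qed
    then have "Y = (\<Union>C\<in>L. filled C - C)" unfolding Y_def by blast
    moreover have "openin (top_of_set X) (\<Union>C\<in>L. filled C - C)"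
      using openin_filled_interior unfolding L_def by blast
    ultimately have opY: "openin (top_of_set X) Y" by simp
    then obtain O1 where O1: "open O1" "Y = X \<inter> O1" by (auto simp: openin_open)
    define B where "B = closure Y - O1"
    have clB: "closed B" unfolding B_def using O1 by (simp add: closed_Diff)
    have cYX: "closure Y \<subseteq> X" using YX closX by (rule closure_minimal)
    have BY: "B \<inter> Y = {}" unfolding B_def using O1 by blast
    have "B \<subseteq> M"
    proof
      fix z assume z: "z \<in> B"
      then have zX: "z \<in> X" and zY: "z \<notin> Y" and zcl: "z \<in> closure Y"
        using cYX BY unfolding B_def by blast+
      have zx: "z \<noteq> x" using zY xY by blast
      \<comment> \<open>\<open>z\<close> might a priori be \<open>p\<close> or \<open>q\<close>; the other of the two points serves as well\<close>
      obtain w where w: "w \<in> {p, q}" "z \<noteq> w" using pq by blast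
      define e where "e = min (dist z x) (dist z w)"
      have "e > 0" using zx w unfolding e_def by simp
      then obtain N where N: "open N" "z \<in> N" "N \<subseteq> ball z e" "connected (X - N)"
        using cutsX zX unfolding small_cuts_def by blast
      have "x \<notin> N" "w \<notin> N" using N(3) unfolding e_def by auto
      then have "\<forall>C\<in>L. \<not> C \<subseteq> N"
        using filled_not_subset_cut[of _ x N] N(4) w(1) unfolding L_def by blast
      moreover have "z \<in> closure (\<Union>L)"
        unfolding closure_approachable
      proof (intro allI impI)
        fix r :: real assume "r > 0"
        then obtain h where h: "h \<in> Y" "dist h z < r" using zcl unfolding closure_approachable by blast
        then obtain C where C: "C \<in> L" "h \<in> filled C" unfolding Y_def by blast
        \<comment> \<open>a segment from \<open>h\<close> inside to \<open>z\<close> outside the filling of \<open>C\<close> hits \<open>C\<close>\<close>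
        have "convex (X \<inter> ball z r)" using convX by (intro convex_Int) auto
        moreover have "z \<notin> filled C" using zY C unfolding Y_def by blast
        ultimately have "(X \<inter> ball z r) \<inter> C \<noteq> {}"
          using filled_boundary[of C "X \<inter> ball z r" h z] C h YX zX \<open>r > 0\<close> convex_connected
          unfolding L_def by (auto simp: dist_commute)
        then show "\<exists>y\<in>\<Union> L. dist y z < r" using C by (auto simp: dist_commute)
      qed
      moreover have "L \<subseteq> components M" unfolding L_def by blast
      ultimately show "z \<in> M" using loose zX N unfolding loosely_closed_def by blast
    qed
    have pB: "p \<notin> closure Y" using \<open>B \<subseteq> M\<close> pX pY O1 unfolding B_def by blast
    have "separates X B {x} {p}"
      unfolding separates_def
    proof (intro allI impI notI, elim conjE)
      fix W assume W: "W \<subseteq> X" "connected W" "W \<inter> {x} \<noteq> {}" "W \<inter> {p} \<noteq> {}" "W \<inter> B = {}"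
      have "O1 \<inter> W = {} \<or> (- closure Y) \<inter> W = {}"
      proof (rule connectedD[OF W(2) O1(1)])
        show "open (- closure Y)" by (simp add: open_Compl)
        have "O1 \<inter> W \<subseteq> Y" using O1 W(1) by blast
        then show "O1 \<inter> - closure Y \<inter> W = {}" using closure_subset[of Y] by blast
        show "W \<subseteq> O1 \<union> - closure Y" using W(5) unfolding B_def by blast
      qed
      then show False using W(3,4) pB xY O1 by blast
    qed
    moreover have "x \<in> X - B" "p \<in> X - B" "B \<subseteq> X" using xX xY BY pX \<open>B \<subseteq> M\<close> MX by blast+
    ultimately obtain T where T: "T \<subseteq> B" "connected T" "separates X T {x} {p}"
      using separation_by_connected_subset[OF convX closX clB] by metis
    have Tne: "T \<noteq> {}"
      using separatesD[OF T(3) subset_refl convex_connected[OF convX] xX _ _] pX by blast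
    then obtain C where C: "C \<in> components M" "T \<subseteq> C"
      using exists_component_superset[of T M] T \<open>B \<subseteq> M\<close> by blast
    have "x \<in> filled C"
    proof (rule ccontr)
      assume "x \<notin> filled C"
      then have "x \<in> outer C" using xX unfolding filled_def by blast
      then have "\<exists>s. s \<in> outer C \<and> s \<in> T"
        using separatesD[OF T(3) _ outer(1)[OF C(1)], of x p] outer[OF C(1)] by blast
      then show False using outer(2)[OF C(1)] C(2) by blast
    qed
    then have "C \<subseteq> Y" using C subset_filled[OF C(1)] unfolding Y_def L_def by blast
    then show False using Tne T(1) C(2) BY by blast
  qed
  then show thesis using that by blast
qed

text \<open>If the complement of all fillings fell apart, a connected closed set \<open>T\<close> in the union of the
  fillings would separate two of its points. The maximal fillings that meet \<open>T\<close> are disjoint, and a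
  separation of the union \<open>V\<close> of the corresponding components would split \<open>T\<close> accordingly. So \<open>V\<close> is
  connected, which makes it part of a single component of \<open>M\<close>; then \<open>T\<close> lies in one filling, whose
  complement is connected and contains the two points.\<close>

lemma connected_outer_all: "connected (X - (\<Union>C\<in>components M. filled C))"
proof (rule ccontr)
  define D where "D = X - (\<Union>C\<in>components M. filled C)"
  assume "\<not> connected (X - (\<Union>C\<in>components M. filled C))"
  then have "\<not> connected D" unfolding D_def .
  then obtain O1 O2 where O12: "open O1" "open O2" "O1 \<inter> D \<noteq> {}" "O2 \<inter> D \<noteq> {}"
      "O1 \<inter> O2 \<inter> D = {}" "D \<subseteq> O1 \<union> O2"
    unfolding connected_def by blast
  define A where "A = O1 \<inter> D"
  define B where "B = O2 \<inter> D"
  obtain a b where a: "a \<in> A" and b: "b \<in> B" using O12(3,4) unfolding A_def B_def by blast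
  have ne: "A \<noteq> {}" "B \<noteq> {}" using a b by blast+
  have *: "O1 \<inter> closure B = {}" "O2 \<inter> closure A = {}"
    using O12(1,2,5) by (auto simp: open_Int_closure_eq_empty A_def B_def)
  have posB: "infdist x B > 0" if "x \<in> A" for x
  proof -
    have "x \<notin> closure B" using that *(1) unfolding A_def by blast
    then show ?thesis
      using in_closure_iff_infdist_zero[OF ne(2), of x] infdist_nonneg[of x B] by linarith
  qed
  have posA: "infdist x A > 0" if "x \<in> B" for x
  proof -
    have "x \<notin> closure A" using that *(2) unfolding B_def by blast
    then show ?thesis
      using in_closure_iff_infdist_zero[OF ne(1), of x] infdist_nonneg[of x A] by linarith
  qed
  \<comment> \<open>the points equidistant from both parts form a closed separator\<close>
  define S where "S = X \<inter> {x. infdist x A = infdist x B}"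
  have clS: "closed S"
    unfolding S_def using closX by (intro closed_Int closed_Collect_eq continuous_intros)
  have SD: "S \<inter> D = {}"
  proof -
    have "infdist x A \<noteq> infdist x B" if "x \<in> D" for x
    proof -
      have "x \<in> A \<or> x \<in> B" using that O12(6) unfolding A_def B_def by blast
      then show ?thesis using posA[of x] posB[of x] by auto
    qed
    then show ?thesis unfolding S_def by blast
  qed
  have "separates X S {a} {b}"
    unfolding separates_def
  proof (intro allI impI notI, elim conjE)
    fix W assume W: "W \<subseteq> X" "connected W" "W \<inter> {a} \<noteq> {}" "W \<inter> {b} \<noteq> {}" "W \<inter> S = {}"
    define g where "g x = infdist x A - infdist x B" for x
    have "connected (g ` W)"
      unfolding g_def using W(2) by (intro connected_continuous_image continuous_intros)
    moreover have "g a \<in> g ` W" "g b \<in> g ` W" using W by auto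
    moreover have "g a \<le> 0" "0 \<le> g b"
      using posB[OF a] posA[OF b] a b unfolding g_def by auto
    ultimately have "0 \<in> g ` W" using connectedD_interval[of "g ` W" "g a" "g b" 0] by blast
    then obtain w where "w \<in> W" "g w = 0" by auto
    then have "w \<in> S" using W(1) unfolding S_def g_def by auto
    then show False using W(5) \<open>w \<in> W\<close> by blast
  qed
  moreover have aD: "a \<in> D" and bD: "b \<in> D" using a b unfolding A_def B_def by blast+
  moreover have "a \<in> X - S" "b \<in> X - S" "S \<subseteq> X"
    using SD aD bD unfolding S_def D_def by blast+
  ultimately obtain T where T: "T \<subseteq> S" "connected T" "separates X T {a} {b}"
    using separation_by_connected_subset[OF convX closX clS, of a b] by metis
  have Th: "\<exists>C\<in>components M. t \<in> filled C" if "t \<in> T" for t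
    using that T(1) SD unfolding S_def D_def by blast
  have TX: "T \<subseteq> X" using T(1) unfolding S_def by blast
  define topmost where "topmost C \<longleftrightarrow> C \<in> components M \<and> filled C \<inter> T \<noteq> {} \<and>
    (\<forall>C'\<in>components M. filled C' \<inter> filled C \<noteq> {} \<longrightarrow> filled C' \<subseteq> filled C)" for C
  have topmost_ex: "\<exists>C. topmost C \<and> t \<in> filled C" if "t \<in> T" for t
  proof -
    obtain C0 where "C0 \<in> components M" "t \<in> filled C0" using Th[OF \<open>t \<in> T\<close>] by blast
    then obtain C where C: "C \<in> components M" "t \<in> filled C"
        "\<And>C'. \<lbrakk>C' \<in> components M; t \<in> filled C'\<rbrakk> \<Longrightarrow> filled C' \<subseteq> filled C"
      using maximal_filled_exists by metis
    have "filled C' \<subseteq> filled C" if C': "C' \<in> components M" "filled C' \<inter> filled C \<noteq> {}" for C'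
    proof (cases "C' = C")
      case False
      then show ?thesis
        using filled_cases[OF C(1) C'(1)] C(2) C(3)[OF C'(1)] C'(2) by blast
    qed simp
    then show ?thesis using C that unfolding topmost_def by blast
  qed
  have topmost_eq: "C = C'" if "topmost C" "topmost C'" "filled C \<inter> filled C' \<noteq> {}" for C C'
  proof (rule ccontr)
    assume "C \<noteq> C'"
    have c: "C \<in> components M" "C' \<in> components M" using that unfolding topmost_def by blast+
    have "filled C = filled C'" using that unfolding topmost_def by blast
    then show False
      using filled_cases[OF c \<open>C \<noteq> C'\<close>] that(3) component(3)[OF c(1)] component(3)[OF c(2)]
        subset_filled[OF c(1)] subset_filled[OF c(2)] by blast
  qed
  define V where "V = \<Union>{C. topmost C}"
  have VM: "V \<subseteq> M" unfolding V_def topmost_def using component(4) by blast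
  have "connected V"
  proof (rule ccontr)
    assume "\<not> connected V"
    then obtain G1 G2 where G: "open G1" "open G2" "G1 \<inter> V \<noteq> {}" "G2 \<inter> V \<noteq> {}"
        "G1 \<inter> G2 \<inter> V = {}" "V \<subseteq> G1 \<union> G2"
      unfolding connected_def by blast
    have side: "C \<subseteq> G1 \<or> C \<subseteq> G2" if "topmost C" for C
    proof -
      have "C \<subseteq> V" "connected C" using that component(2) unfolding V_def topmost_def by blast+
      then have "G1 \<inter> C = {} \<or> G2 \<inter> C = {}"
        using connectedD[OF \<open>connected C\<close> G(1,2)] G(5,6) by blast
      then show ?thesis using \<open>C \<subseteq> V\<close> G(6) by blast
    qed
    define R where "R G = T \<inter> (\<Union>C\<in>{C. topmost C \<and> C \<subseteq> G}. filled C)" for G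
    have opR: "openin (top_of_set T) (R G)" if "open G" and G': "\<And>C. topmost C \<Longrightarrow> C \<inter> G \<noteq> {} \<Longrightarrow> C \<subseteq> G" for G
    proof (subst openin_subopen, intro ballI)
      fix t assume "t \<in> R G"
      then obtain C where C: "topmost C" "C \<subseteq> G" "t \<in> filled C" and tT: "t \<in> T" unfolding R_def by blast
      have Cc: "C \<in> components M" using C unfolding topmost_def by blast
      show "\<exists>U. openin (top_of_set T) U \<and> t \<in> U \<and> U \<subseteq> R G"
      proof (cases "t \<in> C")
        case False
        obtain H where H: "open H" "filled C - C = X \<inter> H"
          using openin_filled_interior[OF Cc] by (auto simp: openin_open)
        have "T \<inter> H \<subseteq> R G" using H TX C unfolding R_def by blast
        moreover have "t \<in> T \<inter> H" using H False C tT TX by blast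
        ultimately show ?thesis using H(1) openin_open_Int by blast
      next
        case True
        then obtain r where r: "r > 0" "ball t r \<subseteq> G"
          using C(2) \<open>open G\<close> open_contains_ball by blast
        \<comment> \<open>a segment from \<open>s\<close> to \<open>t\<close> hits the component around \<open>s\<close> within \<open>G\<close>\<close>
        have "T \<inter> ball t r \<subseteq> R G"
        proof
          fix s assume s: "s \<in> T \<inter> ball t r"
          then obtain C' where C': "topmost C'" "s \<in> filled C'" using topmost_ex by blast
          have "C' \<subseteq> G"
          proof (cases "C' = C")
            case False
            then have "t \<notin> filled C'" using topmost_eq[OF C'(1) C(1)] C(3) by blast
            moreover have "connected (X \<inter> ball t r)"
              using convX by (intro convex_connected convex_Int) auto
            ultimately have "(X \<inter> ball t r) \<inter> C' \<noteq> {}"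
              using filled_boundary[of C' "X \<inter> ball t r" s t] C' s tT TX r(1)
              unfolding topmost_def by auto
            then show ?thesis using G'[OF C'(1)] r(2) by blast
          qed (use C in simp)
          then show "s \<in> R G" using s C' unfolding R_def by blast
        qed
        moreover have "t \<in> T \<inter> ball t r" using tT r by simp
        ultimately show ?thesis using openin_open_Int[OF open_ball] by blast
      qed
    qed
    have G12: "\<And>C. topmost C \<Longrightarrow> C \<inter> G1 \<noteq> {} \<Longrightarrow> C \<subseteq> G1"
        "\<And>C. topmost C \<Longrightarrow> C \<inter> G2 \<noteq> {} \<Longrightarrow> C \<subseteq> G2"
      using side G(5) unfolding V_def by blast+
    have "openin (top_of_set T) (R G1)" "openin (top_of_set T) (R G2)"
      using opR[OF G(1) G12(1)] opR[OF G(2) G12(2)] by blast+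
    moreover have "T \<subseteq> R G1 \<union> R G2"
    proof
      fix t assume "t \<in> T"
      then obtain C where "topmost C" "t \<in> filled C" using topmost_ex by blast
      then show "t \<in> R G1 \<union> R G2" using side[of C] \<open>t \<in> T\<close> unfolding R_def by blast
    qed
    moreover have "R G1 \<inter> R G2 = {}"
    proof (rule ccontr)
      assume "R G1 \<inter> R G2 \<noteq> {}"
      then obtain C C' where "topmost C" "topmost C'" "C \<subseteq> G1" "C' \<subseteq> G2" "filled C \<inter> filled C' \<noteq> {}"
        unfolding R_def by blast
      moreover from this have "C = C'" using topmost_eq by blast
      moreover have "C \<noteq> {}" using \<open>topmost C\<close> component(3) unfolding topmost_def by blast
      ultimately show False using G(5) unfolding V_def by blast
    qed
    moreover have "R G \<noteq> {}" if meets: "G \<inter> V \<noteq> {}" and G': "\<And>C. topmost C \<Longrightarrow> C \<inter> G \<noteq> {} \<Longrightarrow> C \<subseteq> G" for G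
    proof -
      obtain C where C: "topmost C" "C \<inter> G \<noteq> {}" using meets unfolding V_def by blast
      then have "C \<subseteq> G" by (rule G')
      moreover have "filled C \<inter> T \<noteq> {}" using C(1) unfolding topmost_def by blast
      ultimately show ?thesis using C(1) unfolding R_def by blast
    qed
    then have "R G1 \<noteq> {}" "R G2 \<noteq> {}"
      using G12 G(3,4) by blast+
    ultimately show False using T(2) unfolding connected_openin by blast
  qed
  have "T \<noteq> {}"
    using separatesD[OF T(3) subset_refl convex_connected[OF convX], of a b] aD bD
    unfolding D_def by blast
  then have "V \<noteq> {}" "M \<noteq> {}" using topmost_ex component(3) VM unfolding V_def topmost_def by blast+
  then obtain C where C: "C \<in> components M" "V \<subseteq> C"
    using exists_component_superset[OF VM _ \<open>connected V\<close>] by blast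
  have "T \<subseteq> filled C"
  proof
    fix t assume "t \<in> T"
    then obtain C' where C': "topmost C'" "t \<in> filled C'" using topmost_ex by blast
    then have "C' \<subseteq> C" "C' \<in> components M" using C(2) unfolding V_def topmost_def by blast+
    then have "C' = C" using C(1) components_nonoverlap[of C' M C] component(3) by blast
    then show "t \<in> filled C" using C' by simp
  qed
  moreover have "\<exists>s. s \<in> outer C \<and> s \<in> T"
    using separatesD[OF T(3) _ outer(1)[OF C(1)], of a b] outer(2)[OF C(1)] aD bD C(1)
    unfolding D_def filled_def by blast
  ultimately show False unfolding filled_def by blast
qed

end

text \<open>Otherwise the complement of all fillings of components of \<open>M\<close> is a connected set that joins \<open>p\<close>
  to \<open>q\<close> off \<open>M\<close>.\<close>

theorem loosely_closed_separation_by_component: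
  fixes X M :: "'a::euclidean_space set"
  assumes "convex X" "closed X" "small_cuts X" "loosely_closed X M"
    and "p \<in> X - M" "q \<in> X - M" "p \<noteq> q" "separates X M {p} {q}"
  obtains C where "C \<in> components M" "separates X C {p} {q}"
proof (rule ccontr)
  assume no: "\<not> thesis"
  interpret non_separating_components X M p q
    using assms(1-7) no that unfolding separates_points_iff by unfold_locales blast+
  let ?D = "X - (\<Union>C\<in>components M. filled C)"
  have "p \<in> ?D" "q \<in> ?D" using outer(3,4) pX qX unfolding filled_def by blast+
  moreover have "M \<subseteq> (\<Union>C\<in>components M. filled C)"
    using subset_filled Union_components[of M] by blast
  moreover have "?D \<subseteq> X" by blast
  ultimately have "\<exists>s. s \<in> ?D \<and> s \<in> M"
    using separatesD[OF assms(8) _ connected_outer_all, of p q] by blast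
  then show False using \<open>M \<subseteq> _\<close> by blast
qed

section \<open>Connectivity functions\<close>

text \<open>Otherwise \<open>N\<close> times the complement of \<open>J\<close> isolates the point over \<open>z\<close> in the graph over the
  connected set \<open>insert z Z\<close>.\<close>

lemma connectivity_limit:
  fixes X :: "'a::metric_space set"
  assumes F: "connectivity_on X F" and Z: "Z \<subseteq> X" "connected Z" "Z \<noteq> {}"
    and z: "z \<in> X" "z \<in> closure Z" and N: "open N" "z \<in> N"
    and J: "closed J" "\<And>w. w \<in> Z \<inter> N \<Longrightarrow> F w \<in> J"
  shows "F z \<in> J"
proof (rule ccontr)
  assume nJ: "F z \<notin> J"
  then have "z \<notin> Z" using J N by blast
  have "connected (insert z Z)"
    by (rule connected_intermediate_closure[OF Z(2)]) (use z closure_subset in auto)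
  then have con: "connected (graph_on (insert z Z) F)"
    using F Z(1) z(1) unfolding connectivity_on_def by blast
  have "(N \<times> - J) \<inter> graph_on (insert z Z) F = {} \<or>
        (- {(z, F z)}) \<inter> graph_on (insert z Z) F = {}"
  proof (rule connectedD[OF con])
    show "open (N \<times> - J)" using N J by (simp add: open_Times open_Compl)
    show "open (- {(z, F z)})" by (simp add: open_Compl)
    show "(N \<times> - J) \<inter> - {(z, F z)} \<inter> graph_on (insert z Z) F = {}"
      using J(2) unfolding graph_on_def by auto
    show "graph_on (insert z Z) F \<subseteq> (N \<times> - J) \<union> - {(z, F z)}" using N nJ by auto
  qed
  then show False using Z(3) \<open>z \<notin> Z\<close> N nJ unfolding graph_on_def by fastforce
qed

text \<open>The sets \<open>C\<close> need not be connected to each other near \<open>z\<close>: the connected set \<open>X - N\<close> links them all,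
  and the values of \<open>F\<close> there are irrelevant because it stays away from \<open>z\<close>.\<close>

lemma connectivity_limit_family:
  fixes X :: "'a::metric_space set"
  assumes F: "connectivity_on X F" and z: "z \<in> X" "z \<in> closure (\<Union>L)"
    and L: "\<And>C. C \<in> L \<Longrightarrow> C \<subseteq> X \<and> connected C \<and> \<not> C \<subseteq> N"
    and N: "open N" "z \<in> N" "connected (X - N)"
    and J: "closed J" "\<And>C w. C \<in> L \<Longrightarrow> w \<in> C \<Longrightarrow> F w \<in> J"
  shows "F z \<in> J"
proof -
  define Z where "Z = (\<Union>C\<in>L. (X - N) \<union> C)"
  have "L \<noteq> {}" using z(2) by auto
  then obtain C where C: "C \<in> L" by blast
  have "connected Z"
    unfolding Z_def
  proof (rule connected_Union, safe)
    fix C assume "C \<in> L"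
    then show "connected ((X - N) \<union> C)"
      using connected_Un[OF N(3), of C] L[of C] by blast
  next
    assume "\<Inter> ((\<lambda>C. X - N \<union> C) ` L) = {}"
    moreover have "X - N \<subseteq> \<Inter> ((\<lambda>C. X - N \<union> C) ` L)" by blast
    ultimately show False using L[OF C] by blast
  qed
  moreover have "Z \<subseteq> X" "Z \<noteq> {}" using L C unfolding Z_def by blast+
  moreover have "\<Union>L \<subseteq> Z" unfolding Z_def by blast
  then have "z \<in> closure Z" using z(2) closure_mono by blast
  moreover have "F w \<in> J" if "w \<in> Z \<inter> N" for w
    using that J(2) unfolding Z_def by blast
  ultimately show ?thesis using connectivity_limit[OF F _ _ _ z(1) _ N(1,2) J(1)] by blast
qed

text \<open>The case \<open>N = UNIV\<close> of \<open>connectivity_limit\<close> shows that a component absorbs its limit points.\<close>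

lemma loosely_closed_vimage:
  fixes X :: "'a::metric_space set"
  assumes F: "connectivity_on X F" and X: "closed X" and J: "closed J"
  shows "loosely_closed X {z \<in> X. F z \<in> J}" (is "loosely_closed X ?M")
  unfolding loosely_closed_def
proof (intro conjI ballI allI impI, safe)
  fix C assume C: "C \<in> components ?M"
  then have c: "connected C" "C \<noteq> {}" "C \<subseteq> ?M"
    using in_components_connected in_components_nonempty in_components_subset by blast+
  have "closure C \<subseteq> C"
  proof
    fix z assume z: "z \<in> closure C"
    have zX: "z \<in> X" using z c(3) X closure_minimal[of C X] by blast
    have "F z \<in> J"
      by (rule connectivity_limit[OF F _ c(1,2) zX z open_UNIV _ J]) (use c(3) in auto)
    then have "insert z C \<subseteq> ?M" using c(3) zX by blast
    moreover have "connected (insert z C)"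
      by (rule connected_intermediate_closure[OF c(1)]) (use z closure_subset in auto)
    moreover have "C \<inter> insert z C \<noteq> {}" using c(2) by blast
    ultimately have "insert z C \<subseteq> C" using components_maximal[OF C] by blast
    then show "z \<in> C" by blast
  qed
  then show "closed C" by (simp add: closure_subset_eq)
next
  fix L z N
  assume L: "L \<subseteq> components ?M" and z: "z \<in> X" "z \<in> closure (\<Union>L)"
    and N: "open N" "z \<in> N" "connected (X - N)" "\<forall>C\<in>L. \<not> C \<subseteq> N"
  have *: "C \<subseteq> ?M" "connected C" if "C \<in> L" for C
    using that L in_components_connected in_components_subset by blast+
  show "F z \<in> J"
    by (rule connectivity_limit_family[OF F z _ N(1-3) J]) (use * N(4) in blast)+
qed

text \<open>An open square of side at most one leaves, besides the parts of the strip to its left and right,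
  a horizontal band above or below that connects them.\<close>

lemma small_cuts_strip: "small_cuts (UNIV \<times> {0..1} :: (real \<times> real) set)"
  unfolding small_cuts_def
proof (intro ballI allI impI)
  fix z :: "real \<times> real" and e :: real
  assume z: "z \<in> UNIV \<times> {0..1}" and e: "e > 0"
  obtain a t where at: "z = (a, t)" by fastforce
  with z have t: "0 \<le> t" "t \<le> 1" by auto
  define r where "r = min (e/2) (1/2)"
  have r: "r > 0" "r \<le> e/2" "r \<le> 1/2" using e unfolding r_def by auto
  define N where "N = {a-r<..<a+r} \<times> {t-r<..<t+r}"
  define P where "P = {..a-r} \<times> {0..1::real}"
  define Q where "Q = {a+r..} \<times> {0..1::real}"
  define R where "R = (UNIV::real set) \<times> {t+r..1}"
  define S where "S = (UNIV::real set) \<times> {0..t-r}"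
  have con: "connected P" "connected Q" "connected R" "connected S"
    unfolding P_def Q_def R_def S_def by (simp_all add: connected_Times)
  have "UNIV \<times> {0..1} - N = P \<union> Q \<union> R \<union> S"
    unfolding N_def P_def Q_def R_def S_def using r t by auto
  moreover have "connected (P \<union> Q \<union> R \<union> S)"
  proof -
    have PR: "P \<inter> R \<noteq> {}" "Q \<inter> R \<noteq> {}" if "t + r \<le> 1"
    proof -
      have "(a-r, 1) \<in> P \<inter> R" "(a+r, 1) \<in> Q \<inter> R" using that unfolding P_def Q_def R_def by auto
      then show "P \<inter> R \<noteq> {}" "Q \<inter> R \<noteq> {}" by blast+
    qed
    have PS: "P \<inter> S \<noteq> {}" "Q \<inter> S \<noteq> {}" if "0 \<le> t - r"
    proof -
      have "(a-r, 0) \<in> P \<inter> S" "(a+r, 0) \<in> Q \<inter> S" using that unfolding P_def Q_def S_def by auto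
      then show "P \<inter> S \<noteq> {}" "Q \<inter> S \<noteq> {}" by blast+
    qed
    have R0: "R = {}" if "\<not> t + r \<le> 1" using that unfolding R_def by auto
    have S0: "S = {}" if "\<not> 0 \<le> t - r" using that unfolding S_def by auto
    consider "t + r \<le> 1" "0 \<le> t - r" | "t + r \<le> 1" "\<not> 0 \<le> t - r" | "\<not> t + r \<le> 1" "0 \<le> t - r"
      using r by linarith
    then show ?thesis
    proof cases
      case 1
      have "connected ((P \<union> R) \<union> (Q \<union> R) \<union> (P \<union> S))"
        using PR[OF 1(1)] PS[OF 1(2)] con by (intro connected_Un) auto
      moreover have "(P \<union> R) \<union> (Q \<union> R) \<union> (P \<union> S) = P \<union> Q \<union> R \<union> S" by blast
      ultimately show ?thesis by simp
    next
      case 2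
      have "connected ((P \<union> R) \<union> (Q \<union> R))"
        using PR[OF 2(1)] con by (intro connected_Un) auto
      moreover have "(P \<union> R) \<union> (Q \<union> R) = P \<union> Q \<union> R \<union> S" using S0 2 by blast
      ultimately show ?thesis by simp
    next
      case 3
      have "connected ((P \<union> S) \<union> (Q \<union> S))"
        using PS[OF 3(2)] con by (intro connected_Un) auto
      moreover have "(P \<union> S) \<union> (Q \<union> S) = P \<union> Q \<union> R \<union> S" using R0 3 by blast
      ultimately show ?thesis by simp
    qed
  qed
  moreover have "N \<subseteq> ball z e"
  proof
    fix w assume "w \<in> N"
    then obtain x y where w: "w = (x, y)" "\<bar>a - x\<bar> < r" "\<bar>t - y\<bar> < r"
      unfolding N_def by (auto simp: abs_less_iff)
    have "dist z w \<le> \<bar>a - x\<bar> + \<bar>t - y\<bar>"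
      unfolding at w dist_Pair_Pair dist_real_def using sqrt_sum_squares_le_sum_abs by simp
    then show "w \<in> ball z e" using w r by simp
  qed
  moreover have "open N" "z \<in> N" unfolding N_def at using r by (simp_all add: open_Times)
  ultimately show "\<exists>N. open N \<and> z \<in> N \<and> N \<subseteq> ball z e \<and> connected (UNIV \<times> {0..1} - N)" by metis
qed

lemma loosely_closed_component: "\<lbrakk>loosely_closed X M; C \<in> components M\<rbrakk> \<Longrightarrow> closed C"
  unfolding loosely_closed_def by simp

text \<open>The image of a connected set under a connectivity function is an interval, so the whole level set
  separates.\<close>

lemma level_component_separates:
  fixes X :: "'a::euclidean_space set"
  assumes X: "convex X" "closed X" "small_cuts X" and F: "connectivity_on X F"
    and pq: "p \<in> X" "q \<in> X" "F p < y" "y < F q"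
  obtains C where "C \<in> components {z \<in> X. F z = y}" "closed C" "separates X C {p} {q}"
proof -
  have lc: "loosely_closed X {z \<in> X. F z = y}"
    using loosely_closed_vimage[OF F X(2), of "{y}"] by simp
  have sep: "separates X {z \<in> X. F z = y} {p} {q}"
    unfolding separates_def
  proof (intro allI impI, elim conjE)
    fix W assume W: "W \<subseteq> X" "connected W" "W \<inter> {p} \<noteq> {}" "W \<inter> {q} \<noteq> {}"
    have "connected (snd ` graph_on W F)"
      using F W(1,2) unfolding connectivity_on_def
      by (intro connected_continuous_image continuous_intros) blast
    then have "connected (F ` W)" unfolding graph_on_def by (simp add: image_image)
    moreover have "F p \<in> F ` W" "F q \<in> F ` W" using W by auto
    ultimately have "y \<in> F ` W" using pq connectedD_interval[of "F ` W" "F p" "F q" y] by auto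
    then show "W \<inter> {z \<in> X. F z = y} \<noteq> {}" using W(1) by blast
  qed
  have ends: "p \<in> X - {z \<in> X. F z = y}" "q \<in> X - {z \<in> X. F z = y}" "p \<noteq> q"
    using pq by auto
  obtain C where C: "C \<in> components {z \<in> X. F z = y}" "separates X C {p} {q}"
    by (rule loosely_closed_separation_by_component[OF X lc ends sep])
  then show ?thesis using that loosely_closed_component[OF lc] by blast
qed

section \<open>Dense chains and perfect sets of reals\<close>

text \<open>A chain from \<open>a\<close> to \<open>b\<close> that is maximal with respect to inclusion.\<close>

lemma dense_chain_exists:
  fixes R :: "'a \<Rightarrow> 'a \<Rightarrow> bool"
  assumes irr: "\<And>x. \<not> R x x" and tr: "\<And>x y z. \<lbrakk>R x y; R y z\<rbrakk> \<Longrightarrow> R x z"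
    and dense: "\<And>x y. R x y \<Longrightarrow> \<exists>z. R x z \<and> R z y" and ab: "R a b"
  obtains T where "a \<in> T" "b \<in> T"
    "\<And>x. x \<in> T \<Longrightarrow> x = a \<or> R a x" "\<And>x. x \<in> T \<Longrightarrow> x = b \<or> R x b"
    "\<And>x y. \<lbrakk>x \<in> T; y \<in> T\<rbrakk> \<Longrightarrow> x = y \<or> R x y \<or> R y x"
    "\<And>x y. \<lbrakk>x \<in> T; y \<in> T; R x y\<rbrakk> \<Longrightarrow> \<exists>z\<in>T. R x z \<and> R z y"
proof -
  define A where "A = {T. a \<in> T \<and> b \<in> T \<and> (\<forall>x\<in>T. x = a \<or> R a x) \<and> (\<forall>x\<in>T. x = b \<or> R x b) \<and>
    (\<forall>x\<in>T. \<forall>y\<in>T. x = y \<or> R x y \<or> R y x)}"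
  have "{a, b} \<in> A" unfolding A_def using ab by blast
  then have ne: "A \<noteq> {}" by blast
  have "\<exists>M\<in>A. \<forall>Y\<in>A. M \<subseteq> Y \<longrightarrow> Y = M"
  proof (rule subset_Zorn_nonempty[OF ne])
    fix K assume K: "K \<noteq> {}" "subset.chain A K"
    have KA: "\<And>T. T \<in> K \<Longrightarrow> T \<in> A" and KK: "\<And>S T. S \<in> K \<Longrightarrow> T \<in> K \<Longrightarrow> S \<subseteq> T \<or> T \<subseteq> S"
      using K(2) unfolding subset_chain_def by blast+
    have "x = y \<or> R x y \<or> R y x" if xy: "x \<in> \<Union>K" "y \<in> \<Union>K" for x y
    proof -
      obtain S T where "S \<in> K" "T \<in> K" "x \<in> S" "y \<in> T" using xy by blast
      then obtain U where "U \<in> K" "x \<in> U" "y \<in> U" using KK[of S T] by blast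
      then show ?thesis using KA[of U] unfolding A_def by blast
    qed
    moreover have "a \<in> \<Union>K" "b \<in> \<Union>K" using K(1) KA unfolding A_def by blast+
    moreover have "\<forall>x\<in>\<Union>K. x = a \<or> R a x" "\<forall>x\<in>\<Union>K. x = b \<or> R x b"
      using KA unfolding A_def by blast+
    ultimately show "\<Union>K \<in> A" unfolding A_def by blast
  qed
  then obtain T where T: "T \<in> A" and max: "\<And>Y. Y \<in> A \<Longrightarrow> T \<subseteq> Y \<Longrightarrow> Y = T" by blast
  note T' = T[unfolded A_def, simplified]
  have "\<exists>z\<in>T. R x z \<and> R z y" if xy: "x \<in> T" "y \<in> T" "R x y" for x y
  proof (rule ccontr)
    assume no: "\<not> ?thesis"
    obtain z where z: "R x z" "R z y" using dense xy(3) by blast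
    \<comment> \<open>nothing of \<open>T\<close> lies between \<open>x\<close> and \<open>y\<close>, so \<open>z\<close> is comparable with all of \<open>T\<close>\<close>
    have cmp: "R w z \<or> R z w" if "w \<in> T" for w
    proof -
      have "w = x \<or> R w x \<or> R x w" "w = y \<or> R w y \<or> R y w" using T' that xy by blast+
      then show ?thesis using no that z tr[of w x z] tr[of z y w] by blast
    qed
    have "x = a \<or> R a x" "y = b \<or> R y b" using T' xy by blast+
    then have "R a z" "R z b" using z tr[of a x z] tr[of z y b] by metis+
    then have "insert z T \<in> A" unfolding A_def using T' cmp by auto
    then have "insert z T = T" by (rule max) blast
    then show False using no z by blast
  qed
  then show ?thesis using that[of T] T' by blast
qed

text \<open>Four points of \<open>B\<close> between \<open>u\<close> and \<open>v\<close> produce three disjoint intervals, at most one of which is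
  longer than half of \<open>v - u\<close>.\<close>

lemma short_pair:
  fixes B :: "real set"
  assumes dense: "\<forall>u\<in>B. \<forall>v\<in>B. u < v \<longrightarrow> (\<exists>w\<in>B. u < w \<and> w < v)"
    and uv: "u \<in> B" "v \<in> B" "u < v"
  obtains a b c d where "a \<in> B" "b \<in> B" "c \<in> B" "d \<in> B"
    "u \<le> a" "a < b" "b < c" "c < d" "d \<le> v" "b - a \<le> (v - u)/2" "d - c \<le> (v - u)/2"
proof -
  obtain w1 where w1: "w1 \<in> B" "u < w1" "w1 < v" using dense uv by blast
  obtain w2 where w2: "w2 \<in> B" "w1 < w2" "w2 < v" using dense uv w1 by blast
  obtain w3 where w3: "w3 \<in> B" "w2 < w3" "w3 < v" using dense uv w2 by blast
  obtain w4 where w4: "w4 \<in> B" "w3 < w4" "w4 < v" using dense uv w3 by blast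
  consider "w1 - u \<le> (v-u)/2" "w3 - w2 \<le> (v-u)/2" | "w1 - u \<le> (v-u)/2" "v - w4 \<le> (v-u)/2"
    | "w3 - w2 \<le> (v-u)/2" "v - w4 \<le> (v-u)/2"
    using w1 w2 w3 w4 by argo
  then show ?thesis
  proof cases
    case 1 then show ?thesis using that[of u w1 w2 w3] uv w1 w2 w3 by auto
  next
    case 2 then show ?thesis using that[of u w1 w4 v] uv w1 w2 w3 w4 by auto
  next
    case 3 then show ?thesis using that[of w2 w3 w4 v] uv w1 w2 w3 w4 by auto
  qed
qed

text \<open>A Cantor scheme of intervals with end points in \<open>B\<close>, splitting each interval as in
  \<open>short_pair\<close>. The closure of \<open>B\<close> itself would not do: it may contain the ends of a gap in \<open>B\<close>,
  which \<open>B\<close> approximates from one side only.\<close>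

lemma two_sided_perfect_set:
  fixes B :: "real set"
  assumes dense: "\<forall>u\<in>B. \<forall>v\<in>B. u < v \<longrightarrow> (\<exists>w\<in>B. u < w \<and> w < v)"
    and uv0: "u0 \<in> B" "v0 \<in> B" "u0 < v0"
  obtains C where "closed C" "C \<noteq> {}" "\<And>x. x \<in> C \<Longrightarrow> x islimpt C"
    "\<And>x e. \<lbrakk>x \<in> C; e > 0\<rbrakk> \<Longrightarrow> \<exists>u\<in>B. \<exists>v\<in>B. u \<le> x \<and> x \<le> v \<and> v - u < e"
proof -
  define good where "good I \<longleftrightarrow> fst I \<in> B \<and> snd I \<in> B \<and> fst I < snd I" for I :: "real \<times> real"
  define len where "len I = snd I - fst I" for I :: "real \<times> real"
  define seg where "seg I = {fst I..snd I}" for I :: "real \<times> real"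
  define halves where "halves I J J' \<longleftrightarrow> good J \<and> good J' \<and> seg J \<subseteq> seg I \<and> seg J' \<subseteq> seg I \<and>
    seg J \<inter> seg J' = {} \<and> len J \<le> len I / 2 \<and> len J' \<le> len I / 2" for I J J'
  have "\<exists>JJ. halves I (fst JJ) (snd JJ)" if "good I" for I
  proof -
    have "fst I \<in> B" "snd I \<in> B" "fst I < snd I" using that unfolding good_def by auto
    then obtain a b c d where "a \<in> B" "b \<in> B" "c \<in> B" "d \<in> B" "fst I \<le> a" "a < b" "b < c" "c < d"
        "d \<le> snd I" "b - a \<le> (snd I - fst I)/2" "d - c \<le> (snd I - fst I)/2"
      using short_pair[OF dense, of "fst I" "snd I"] by metis
    then have "halves I (a, b) (c, d)" unfolding halves_def good_def seg_def len_def by auto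
    then show ?thesis by (intro exI[of _ "((a,b),(c,d))"]) simp
  qed
  then obtain h where h: "\<And>I. good I \<Longrightarrow> halves I (fst (h I)) (snd (h I))" by metis
  \<comment> \<open>a node is addressed by the list of its turns, the latest turn first\<close>
  define node where "node = rec_list (u0, v0) (\<lambda>b s I. if b then snd (h I) else fst (h I))"
  have node_Nil: "node [] = (u0, v0)"
    and node_Cons: "node (b # s) = (if b then snd (h (node s)) else fst (h (node s)))" for b s
    unfolding node_def by simp_all
  have good: "good (node s)" for s
  proof (induction s)
    case Nil then show ?case using uv0 unfolding node_Nil good_def by simp
  next
    case (Cons b s) then show ?case using h[OF Cons] unfolding node_Cons halves_def by simp
  qed
  have child: "seg (node (b # s)) \<subseteq> seg (node s)" "len (node (b # s)) \<le> len (node s) / 2" for b s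
    using h[OF good[of s]] unfolding node_Cons halves_def by simp_all
  have disj: "seg (node (True # s)) \<inter> seg (node (False # s)) = {}" for s
    using h[OF good[of s]] unfolding node_Cons halves_def by auto
  define lev where "lev n = (\<Union>s\<in>{s. length s = n}. seg (node s))" for n :: nat
  define C where "C = (\<Inter>n. lev n)"
  have len: "len (node s) \<le> (v0 - u0) / 2 ^ length s" for s
  proof (induction s)
    case Nil then show ?case unfolding node_Nil len_def by simp
  next
    case (Cons b s)
    have "len (node (b # s)) \<le> len (node s) / 2" by (rule child)
    also have "\<dots> \<le> (v0 - u0) / 2 ^ length s / 2"
      by (rule divide_right_mono[OF Cons]) simp
    finally show ?case by (simp add: mult.commute)
  qed
  have "finite {s :: bool list. length s = n}" for n
    using finite_lists_length_eq[of "UNIV :: bool set" n] by simp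
  then have "closed (lev n)" for n unfolding lev_def seg_def by (intro closed_UN) auto
  then have clC: "closed C" unfolding C_def by blast
  have short: "\<exists>s. length s = n \<and> x \<in> seg (node s)" if "x \<in> C" for x n
    using that unfolding C_def lev_def by blast
  have small: "\<exists>n. (v0 - u0) / 2 ^ n < e" if "e > 0" for e :: real
  proof -
    have pos: "0 < e / (v0 - u0)" using that uv0(3) by simp
    obtain n where "(1/2) ^ n < e / (v0 - u0)"
      using real_arch_pow_inv[OF pos, of "1/2"] by auto
    then show ?thesis using uv0 by (intro exI[of _ n]) (simp add: field_simps)
  qed
  have anc: "seg (node (t @ s)) \<subseteq> seg (node s)" for t s
    by (induction t) (use child(1) in auto)
  have meet: "\<exists>x\<in>C. x \<in> seg (node s)" for s
  proof -
    define I where "I k = seg (node (replicate k False @ s))" for k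
    have "\<Inter>(range I) \<noteq> {}"
    proof (rule compact_nest)
      show "compact (I k)" "I k \<noteq> {}" for k
        using good[of "replicate k False @ s"] unfolding I_def seg_def good_def by auto
      have "I (Suc k) \<subseteq> I k" for k unfolding I_def using child(1) by simp
      then show "m \<le> n \<Longrightarrow> I n \<subseteq> I m" for m n by (rule lift_Suc_antimono_le)
    qed
    then obtain x where x: "\<And>k. x \<in> I k" by blast
    have "x \<in> lev n" for n
    proof -
      \<comment> \<open>dropping the latest turns leads to the ancestor at depth \<open>n\<close>\<close>
      define t where "t = replicate n False @ s"
      have "x \<in> seg (node t)" using x[of n] unfolding I_def t_def .
      then have "x \<in> seg (node (drop (length t - n) t))"
        using anc[of "take (length t - n) t" "drop (length t - n) t"] by auto
      moreover have "length (drop (length t - n) t) = n" unfolding t_def by simp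
      ultimately show ?thesis unfolding lev_def by blast
    qed
    then show ?thesis using x[of 0] unfolding C_def I_def by auto
  qed
  show thesis
  proof (rule that)
    show "closed C" by (rule clC)
    show "C \<noteq> {}" using meet by blast
    show "x islimpt C" if x: "x \<in> C" for x
      unfolding islimpt_approachable
    proof (intro allI impI)
      fix e :: real assume "e > 0"
      then obtain n where n: "(v0 - u0) / 2 ^ n < e" using small by blast
      obtain s where s: "length s = n" "x \<in> seg (node s)" using short[OF x] by blast
      obtain b where b: "x \<notin> seg (node (b # s))" using disj by blast
      obtain y where y: "y \<in> C" "y \<in> seg (node (b # s))" using meet by blast
      have "y \<in> seg (node s)" using y child(1) by blast
      then have "\<bar>y - x\<bar> \<le> len (node s)" using s(2) unfolding seg_def len_def by auto
      also have "\<dots> < e" using len[of s] n s(1) by simp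
      finally have "dist y x < e" by (simp add: dist_real_def)
      moreover have "y \<noteq> x" using b y by blast
      ultimately show "\<exists>x'\<in>C. x' \<noteq> x \<and> dist x' x < e" using y by blast
    qed
    show "\<exists>u\<in>B. \<exists>v\<in>B. u \<le> x \<and> x \<le> v \<and> v - u < e" if x: "x \<in> C" and "e > 0" for x e
    proof -
      obtain n where n: "(v0 - u0) / 2 ^ n < e" using small \<open>e > 0\<close> by blast
      obtain s where s: "length s = n" "x \<in> seg (node s)" using short[OF x] by blast
      have "snd (node s) - fst (node s) < e" using len[of s] n s(1) unfolding len_def by simp
      then show ?thesis using good[of s] s(2) unfolding good_def seg_def by auto
    qed
  qed
qed

text \<open>A perfect set may have gaps, whose two end points have nothing in between. Keeping only the limits
  from the left discards the upper end points and leaves a densely ordered set.\<close>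

definition left_limits :: "real set \<Rightarrow> real set" where
  "left_limits K = {k \<in> K. \<forall>e<k. \<exists>k'\<in>K. e < k' \<and> k' < k}"

lemma left_limit_between:
  assumes K: "perfect K" and k: "k \<in> K" "k' \<in> K" "k < k'"
  obtains m where "m \<in> left_limits K" "k \<le> m" "m \<le> k'"
proof (cases "k' \<in> left_limits K")
  case False
  then obtain e where e: "e < k'" "\<And>j. j \<in> K \<Longrightarrow> e < j \<Longrightarrow> \<not> j < k'"
    using k unfolding left_limits_def by blast
  then have "k \<le> e" using k by force
  \<comment> \<open>the lower end point of the gap just below \<open>k'\<close>\<close>
  have "compact (K \<inter> {k..e})"
    using K unfolding perfect_def by (simp add: closed_Int_compact)
  then obtain m where m: "m \<in> K \<inter> {k..e}" "\<And>j. j \<in> K \<inter> {k..e} \<Longrightarrow> j \<le> m"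
    using compact_attains_sup[of "K \<inter> {k..e}"] k \<open>k \<le> e\<close> by force
  have "\<exists>j\<in>K. d < j \<and> j < m" if "d < m" for d
  proof -
    define r where "r = min (m - d) (k' - m)"
    have "r > 0" using that m(1) e(1) unfolding r_def by auto
    moreover have "m islimpt K" using K m(1) unfolding perfect_def by blast
    ultimately obtain j where j: "j \<in> K" "j \<noteq> m" "dist j m < r"
      unfolding islimpt_approachable by blast
    then have "d < j" "j < k'" unfolding r_def dist_real_def by auto
    moreover have "\<not> m < j"
    proof
      assume "m < j"
      moreover have "j \<le> e" using e(2)[OF j(1)] \<open>j < k'\<close> by force
      ultimately have "j \<in> K \<inter> {k..e}" using j(1) m(1) by auto
      then show False using m(2) \<open>m < j\<close> by force
    qed
    ultimately show ?thesis using j by force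
  qed
  then have "m \<in> left_limits K" using m(1) unfolding left_limits_def by blast
  then show ?thesis using that m(1) e(1) by auto
qed (use that k in auto)

lemma left_limit_strictly_between:
  assumes K: "perfect K" and y: "y' \<in> left_limits K" "y < y'"
  obtains m where "m \<in> left_limits K" "y < m" "m < y'"
proof -
  obtain k where k: "k \<in> K" "y < k" "k < y'" using y unfolding left_limits_def by blast
  obtain k' where k': "k' \<in> K" "k < k'" "k' < y'" using y k unfolding left_limits_def by blast
  obtain m where "m \<in> left_limits K" "k \<le> m" "m \<le> k'"
    using left_limit_between[OF K k(1) k'(1,2)] .
  then show ?thesis using that k k' by force
qed

text \<open>The points of \<open>B\<close> whose values are far from \<open>f x\<close> cannot accumulate at \<open>x\<close>. The values at the points
  of the closure near \<open>x\<close> are then limits of values close to \<open>f x\<close>.\<close>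

lemma continuous_on_closure_by_limits:
  fixes f :: "real \<Rightarrow> real"
  assumes lim: "\<And>A J x. \<lbrakk>A \<subseteq> B; closed J; f ` A \<subseteq> J; x \<in> closure A\<rbrakk> \<Longrightarrow> f x \<in> J"
  shows "continuous_on (closure B) f"
  unfolding continuous_on_iff
proof (intro ballI allI impI)
  fix x e :: real assume x: "x \<in> closure B" and e: "e > 0"
  define A where "A = {u \<in> B. e/2 \<le> dist (f u) (f x)}"
  have "x \<notin> closure A"
  proof
    assume "x \<in> closure A"
    moreover have "closed {t. e/2 \<le> dist t (f x)}"
      by (intro closed_Collect_le continuous_intros)
    ultimately have "f x \<in> {t. e/2 \<le> dist t (f x)}"
      using lim[of A "{t. e/2 \<le> dist t (f x)}" x] unfolding A_def by blast
    then show False using e by simp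
  qed
  then have "open (- closure A)" "x \<in> - closure A" by auto
  then obtain d where "d > 0" "ball x d \<subseteq> - closure A" by (rule openE)
  then have d: "d > 0" "ball x d \<inter> A = {}" using closure_subset[of A] by auto
  have "dist (f x') (f x) < e" if x': "x' \<in> closure B" "dist x' x < d" for x'
  proof -
    have "x' \<in> closure (B \<inter> ball x d)"
      using x' open_Int_closure_subset[OF open_ball, of x d B] by (auto simp: dist_commute Int_commute)
    moreover have "f ` (B \<inter> ball x d) \<subseteq> {t. dist t (f x) \<le> e/2}"
      using d(2) unfolding A_def by auto
    moreover have "closed {t. dist t (f x) \<le> e/2}"
      by (intro closed_Collect_le continuous_intros)
    ultimately have "f x' \<in> {t. dist t (f x) \<le> e/2}" using lim[of "B \<inter> ball x d"] by blast
    then show ?thesis using e by simp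
  qed
  then show "\<exists>d>0. \<forall>x'\<in>closure B. dist x' x < d \<longrightarrow> dist (f x') (f x) < e" using d(1) by blast
qed

section \<open>Increasing restrictions\<close>

text \<open>Separators of \<open>p\<close> and \<open>q\<close> are compared by which of them is met first on the way from \<open>p\<close>, and a
  dense chain of them is chosen along which the levels increase in \<open>K\<close>. The first points \<open>B\<close> of these
  separators on the bottom edge then increase too. None of the separators fits into a small
  neighbourhood of a point strictly between \<open>a\<close> and \<open>b\<close>, because \<open>p\<close> and \<open>q\<close> are outside of it; so
  \<open>connectivity_limit_family\<close> makes \<open>f\<close> continuous on \<open>closure B\<close> with values in \<open>K\<close>. On \<open>closure B\<close> the
  function may be merely nondecreasing. It is strictly increasing on the perfect subset \<open>C\<close>, since two points
  of \<open>B\<close> lie between any two points of \<open>C\<close>.\<close>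

lemma increasing_cantor_restriction:
  fixes F :: "real \<times> real \<Rightarrow> real" and a b :: real
  assumes F: "connectivity_on (UNIV \<times> {0..1}) F" and "a < b" and K: "cantor_set K"
    and Kab: "K \<subseteq> {F (a, 0)<..<F (b, 0)}"
  obtains C where "cantor_set C" "C \<subseteq> {a<..<b}" "(\<lambda>x. F (x, 0)) ` C \<subseteq> K"
    "continuous_on C (\<lambda>x. F (x, 0))" "strict_mono_on C (\<lambda>x. F (x, 0))"
proof -
  define X :: "(real \<times> real) set" where "X = UNIV \<times> {0..1}"
  define f where "f x = F (x, 0)" for x
  define p where "p = (a, 0::real)"
  define q where "q = (b, 0::real)"
  note F' = F[folded X_def]
  have convX: "convex X" unfolding X_def by (intro convex_Times) auto
  have closX: "closed X" unfolding X_def by (intro closed_Times) auto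
  have cutsX: "small_cuts X" unfolding X_def by (rule small_cuts_strip)
  have conX: "connected X" using convX by (rule convex_connected)
  have pX: "p \<in> X" and qX: "q \<in> X" unfolding X_def p_def q_def by auto
  have perf: "perfect K" and clK: "closed K" using K unfolding cantor_set_def perfect_def by auto
  have LK: "left_limits K \<subseteq> K" unfolding left_limits_def by blast
  have Ky: "F p < y" "y < F q" if "y \<in> left_limits K" for y
    using that LK Kab unfolding p_def q_def by auto

  define level where "level y = components {z \<in> X. F z = y}" for y
  have level: "connected C" "C \<noteq> {}" "C \<subseteq> X" "\<And>z. z \<in> C \<Longrightarrow> F z = y" "closed C"
    if "C \<in> level y" for C y
  proof -
    show "connected C" "C \<noteq> {}" using that in_components_connected in_components_nonempty
      unfolding level_def by blast+
    have "C \<subseteq> {z \<in> X. F z = y}" using that in_components_subset unfolding level_def by blast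
    then show "C \<subseteq> X" "\<And>z. z \<in> C \<Longrightarrow> F z = y" by blast+
    have "loosely_closed X {z \<in> X. F z = y}"
      using loosely_closed_vimage[OF F' closX, of "{y}"] by simp
    then show "closed C" using loosely_closed_component that unfolding level_def by blast
  qed
  have sep_ex: "\<exists>C\<in>level y. separates X C {z} {z'}" if "z \<in> X" "z' \<in> X" "F z < y" "y < F z'" for z z' y
    using level_component_separates[OF convX closX cutsX F' that] unfolding level_def by metis

  \<comment> \<open>a separator at a level strictly between those of \<open>Z\<close> and \<open>Z'\<close> fits between them\<close>
  have insert: "\<exists>C\<in>level y'. separates X Z {p} C \<and> separates X C {p} Z'"
    if Z: "Z \<in> level y" and Z': "connected Z'" "Z' \<noteq> {}" "Z' \<subseteq> X" "\<And>z. z \<in> Z' \<Longrightarrow> F z = y''"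
      and y: "y < y'" "y' < y''" and sep: "separates X Z {p} Z'" for y y' y'' Z Z'
  proof -
    obtain z z' where z: "z \<in> Z" "z' \<in> Z'" using level(2)[OF Z] Z'(2) by blast
    have Fz: "F z = y" "F z' = y''" using z level(4)[OF Z] Z'(4) by auto
    have zX: "z \<in> X" "z' \<in> X" using z level(3)[OF Z] Z'(3) by auto
    obtain C where C: "C \<in> level y'" "separates X C {z} {z'}"
      using sep_ex[OF zX, of y'] Fz y by auto
    have "z' \<notin> Z" using level(4)[OF Z, of z'] Fz y by auto
    moreover have "Z \<inter> C = {}" "Z' \<inter> C = {}"
      using level(4)[OF Z] Z'(4) level(4)[OF C(1)] y by force+
    ultimately have dis: "Z \<inter> C = {}" "Z' \<inter> C = {}" "z' \<notin> Z" by simp_all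
    have "separates X C Z Z'"
      using separates_connected_supersets[OF C(2) z level(1)[OF Z] Z'(1) level(3)[OF Z] Z'(3) dis(1,2)] .
    then show ?thesis
      using separates_between[OF conX level(3,1)[OF Z] level(3,1)[OF C(1)] dis(1) z(2) zX(2) dis(3)
          level(2)[OF Z] pX sep] C(1) by blast
  qed

  define E where "E = {e. fst e \<in> left_limits K \<and> snd e \<in> level (fst e) \<and> separates X (snd e) {p} {q}}"
  define R where "R e e' \<longleftrightarrow> e \<in> E \<and> e' \<in> E \<and> fst e < fst e' \<and> separates X (snd e) {p} (snd e')" for e e'
  have ED: "fst e \<in> left_limits K" "snd e \<in> level (fst e)" "separates X (snd e) {p} {q}" if "e \<in> E" for e
    using that unfolding E_def by auto

  have R_dense: "\<exists>c. R e c \<and> R c e'" if ee: "R e e'" for e e'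
  proof -
    have e: "e \<in> E" "e' \<in> E" "fst e < fst e'" "separates X (snd e) {p} (snd e')"
      using ee unfolding R_def by auto
    obtain y where y: "y \<in> left_limits K" "fst e < y" "y < fst e'"
      using left_limit_strictly_between[OF perf ED(1)[OF e(2)] e(3)] .
    note l' = level[OF ED(2)[OF e(2)]]
    obtain C where C: "C \<in> level y" "separates X (snd e) {p} C" "separates X C {p} (snd e')"
      using insert[OF ED(2)[OF e(1)] l'(1-4) y(2,3) e(4)] by auto
    have "(y, C) \<in> E"
      using y(1) C(1) separates_trans[OF C(3) ED(3)[OF e(2)]] unfolding E_def by simp
    then have "R e (y, C)" "R (y, C) e'" using e y C unfolding R_def by auto
    then show ?thesis by blast
  qed

  obtain e1 e2 where R12: "R e1 e2"
  proof -
    obtain k where "k \<in> K" using K unfolding cantor_set_def by blast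
    then have "k islimpt K" using perf unfolding perfect_def by blast
    then obtain k' where "k' \<in> K" "k' \<noteq> k" unfolding islimpt_approachable using zero_less_one by blast
    then obtain y2 where y2: "y2 \<in> left_limits K"
      using left_limit_between[OF perf, of k k'] left_limit_between[OF perf, of k' k] \<open>k \<in> K\<close>
      by (metis linorder_neqE)
    obtain y1 where y1: "y1 \<in> left_limits K" "y1 < y2"
      using left_limit_strictly_between[OF perf y2, of "y2 - 1"] by auto
    obtain Z1 where Z1: "Z1 \<in> level y1" "separates X Z1 {p} {q}"
      using sep_ex[OF pX qX Ky[OF y1(1)]] by blast
    obtain Z2 where Z2: "Z2 \<in> level y2" "separates X Z1 {p} Z2" "separates X Z2 {p} {q}"
      using insert[OF Z1(1), of "{q}" "F q" y2] Z1(2) y1 Ky[OF y2] qX by auto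
    have "R (y1, Z1) (y2, Z2)" using y1 y2 Z1 Z2 unfolding R_def E_def by simp
    then show thesis by (rule that)
  qed

  obtain T where T: "e1 \<in> T" "e2 \<in> T"
    "\<And>e. e \<in> T \<Longrightarrow> e = e1 \<or> R e1 e" "\<And>e. e \<in> T \<Longrightarrow> e = e2 \<or> R e e2"
    "\<And>e e'. \<lbrakk>e \<in> T; e' \<in> T\<rbrakk> \<Longrightarrow> e = e' \<or> R e e' \<or> R e' e"
    "\<And>e e'. \<lbrakk>e \<in> T; e' \<in> T; R e e'\<rbrakk> \<Longrightarrow> \<exists>c\<in>T. R e c \<and> R c e'"
  proof (rule dense_chain_exists[of R e1 e2])
    show "\<not> R e e" for e unfolding R_def by simp
    show "R e e''" if "R e e'" "R e' e''" for e e' e''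
      using that separates_trans[of X "snd e" "{p}" "snd e'" "snd e''"] unfolding R_def by auto
  qed (use R_dense R12 in blast)+
  have TE: "e \<in> E" if "e \<in> T" for e using T(3)[OF that] R12 unfolding R_def by auto

  \<comment> \<open>the first point of a separator on the bottom edge, seen from \<open>p\<close>\<close>
  have "\<exists>x. a \<le> x \<and> x \<le> b \<and> (x, 0) \<in> snd e \<and> (\<forall>t. a \<le> t \<and> t < x \<longrightarrow> (t, 0) \<notin> snd e)" if e: "e \<in> E" for e
  proof -
    define S where "S = {a..b} \<inter> (\<lambda>x. (x, 0)) -` snd e"
    have "closed ((\<lambda>x::real. (x, 0::real)) -` snd e)"
      using level(5)[OF ED(2)[OF e]] by (intro continuous_closed_vimage continuous_intros)
    then have "compact S" unfolding S_def by (simp add: compact_Int_closed)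
    moreover have "S \<noteq> {}"
    proof -
      have "\<exists>s. s \<in> {a..b} \<times> {0} \<and> s \<in> snd e"
        by (rule separatesD[OF ED(3)[OF e], of _ p q])
          (use \<open>a < b\<close> in \<open>auto simp: X_def p_def q_def connected_Times\<close>)
      then show ?thesis unfolding S_def by auto
    qed
    ultimately obtain x where "x \<in> S" "\<And>t. t \<in> S \<Longrightarrow> x \<le> t" using compact_attains_inf[of S] by blast
    then show ?thesis unfolding S_def by (intro exI[of _ x]) force
  qed
  then obtain g where g: "\<And>e. e \<in> E \<Longrightarrow> a \<le> g e \<and> g e \<le> b \<and> (g e, 0) \<in> snd e \<and>
      (\<forall>t. a \<le> t \<and> t < g e \<longrightarrow> (t, 0) \<notin> snd e)" by metis
  have fg: "f (g e) = fst e" if "e \<in> E" for e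
    using g[OF that] level(4)[OF ED(2)[OF that]] unfolding f_def by blast
  have g_mono: "g e < g e'" if ee: "R e e'" for e e'
  proof -
    have e: "e \<in> E" "e' \<in> E" "fst e < fst e'" "separates X (snd e) {p} (snd e')"
      using ee unfolding R_def by auto
    have "\<exists>s. s \<in> {a..g e'} \<times> {0} \<and> s \<in> snd e"
      by (rule separatesD[OF e(4), of _ p "(g e', 0)"])
        (use g[OF e(2)] in \<open>auto simp: X_def p_def connected_Times\<close>)
    then obtain t where "a \<le> t" "t \<le> g e'" "(t, 0) \<in> snd e" by auto
    then have "g e \<le> g e'" using g[OF e(1)] by force
    moreover have "g e \<noteq> g e'" using fg[OF e(1)] fg[OF e(2)] e(3) by auto
    ultimately show ?thesis by simp
  qed

  define B where "B = g ` T"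
  have e12: "e1 \<in> E" "e2 \<in> E" using R12 unfolding R_def by auto
  have B12: "B \<subseteq> {g e1..g e2}"
    unfolding B_def
  proof (rule image_subsetI)
    fix e assume "e \<in> T"
    then show "g e \<in> {g e1..g e2}"
      using T(3)[of e] T(4)[of e] g_mono[of e1 e] g_mono[of e e2] by auto
  qed
  \<comment> \<open>the chain keeps \<open>closure B\<close> away from \<open>a\<close> and \<open>b\<close>, where separators could shrink to a point\<close>
  have a1: "a < g e1"
  proof -
    have "f a \<noteq> f (g e1)" using Ky(1)[OF ED(1)[OF e12(1)]] fg[OF e12(1)] unfolding f_def p_def by simp
    then show ?thesis using g[OF e12(1)] by (metis less_eq_real_def)
  qed
  have b2: "g e2 < b"
  proof -
    have "f b \<noteq> f (g e2)" using Ky(2)[OF ED(1)[OF e12(2)]] fg[OF e12(2)] unfolding f_def q_def by simp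
    then show ?thesis using g[OF e12(2)] by (metis less_eq_real_def)
  qed
  have clB: "closure B \<subseteq> {g e1..g e2}" using B12 by (rule closure_minimal) simp
  have B_dense: "\<forall>u\<in>B. \<forall>v\<in>B. u < v \<longrightarrow> (\<exists>w\<in>B. u < w \<and> w < v)"
  proof (intro ballI impI)
    fix u v assume "u \<in> B" "v \<in> B" "u < v"
    then obtain e e' where e: "e \<in> T" "e' \<in> T" "u = g e" "v = g e'" unfolding B_def by blast
    have "R e e'" using T(5)[OF e(1,2)] e \<open>u < v\<close> g_mono[of e' e] by auto
    then obtain c where "c \<in> T" "R e c" "R c e'" using T(6)[OF e(1,2)] by blast
    then show "\<exists>w\<in>B. u < w \<and> w < v" using g_mono e unfolding B_def by blast
  qed
  have fB_mono: "f u < f v" if uv: "u \<in> B" "v \<in> B" "u < v" for u v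
  proof -
    obtain e e' where e: "e \<in> T" "e' \<in> T" "u = g e" "v = g e'" using uv unfolding B_def by blast
    have "R e e'" using T(5)[OF e(1,2)] e \<open>u < v\<close> g_mono[of e' e] by auto
    then show ?thesis using fg TE e unfolding R_def by auto
  qed

  have lim: "f x \<in> J" if A: "A \<subseteq> B" "closed J" "f ` A \<subseteq> J" "x \<in> closure A" for A J x
  proof -
    define L where "L = snd ` {e \<in> T. g e \<in> A}"
    have "x \<in> closure B" using closure_mono[OF A(1)] A(4) by blast
    then have "a < x" "x < b" using clB a1 b2 by auto
    have xX: "(x, 0) \<in> X" unfolding X_def by simp
    define r where "r = min (x - a) (b - x)"
    have "r > 0" using \<open>a < x\<close> \<open>x < b\<close> unfolding r_def by simp
    then obtain N where N: "open N" "(x, 0) \<in> N" "N \<subseteq> ball (x, 0) r" "connected (X - N)"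
      using cutsX xX unfolding small_cuts_def by blast
    have "p \<notin> ball (x, 0) r" "q \<notin> ball (x, 0) r"
      unfolding p_def q_def r_def by (auto simp: dist_Pair_Pair dist_real_def)
    then have pqN: "p \<in> X - N" "q \<in> X - N" using N(3) pX qX by blast+
    have "F (x, 0) \<in> J"
    proof (rule connectivity_limit_family[OF F' xX _ _ N(1,2,4) A(2)])
      show "(x, 0) \<in> closure (\<Union>L)"
      proof -
        have "(\<lambda>x. (x, 0)) ` A \<subseteq> \<Union>L"
          using A(1) g TE unfolding L_def B_def by blast
        moreover have "(\<lambda>x. (x, 0)) ` closure A \<subseteq> closure ((\<lambda>x. (x, 0::real)) ` A)"
          by (intro image_closure_subset continuous_intros closed_closure closure_subset)
        ultimately show ?thesis using A(4) closure_mono by blast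
      qed
    next
      fix C assume "C \<in> L"
      then obtain e where e: "e \<in> T" "g e \<in> A" "C = snd e" unfolding L_def by blast
      note lev = level[OF ED(2)[OF TE[OF e(1)]]]
      show "C \<subseteq> X \<and> connected C \<and> \<not> C \<subseteq> N"
        using lev e(3) separatesD[OF ED(3)[OF TE[OF e(1)]] _ N(4), of p q] pqN by blast
      fix w assume "w \<in> C"
      then have "F w = f (g e)" using lev(4) e(3) fg[OF TE[OF e(1)]] by simp
      then show "F w \<in> J" using A(3) e(2) by auto
    qed
    then show ?thesis unfolding f_def .
  qed
  have cont: "continuous_on (closure B) f" by (rule continuous_on_closure_by_limits) (rule lim)

  obtain C where C: "closed C" "C \<noteq> {}" "\<And>x. x \<in> C \<Longrightarrow> x islimpt C"
    "\<And>x e. \<lbrakk>x \<in> C; e > 0\<rbrakk> \<Longrightarrow> \<exists>u\<in>B. \<exists>v\<in>B. u \<le> x \<and> x \<le> v \<and> v - u < e"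
    by (rule two_sided_perfect_set[OF B_dense, of "g e1" "g e2"])
      (use T(1,2) g_mono[OF R12] in \<open>auto simp: B_def\<close>)
  have CB: "C \<subseteq> closure B"
  proof
    fix x assume "x \<in> C"
    show "x \<in> closure B"
      unfolding closure_approachable
    proof (intro allI impI)
      fix e :: real assume "e > 0"
      then obtain u v where "u \<in> B" "u \<le> x" "x \<le> v" "v - u < e" using C(4)[OF \<open>x \<in> C\<close>] by blast
      then show "\<exists>y\<in>B. dist y x < e" by (intro bexI[of _ u]) (auto simp: dist_real_def)
    qed
  qed
  have f_le: "f x \<le> f v" if "x \<in> C" "v \<in> B" "x \<le> v" for x v
  proof (cases "x = v")
    case False
    then have "x \<in> closure (B \<inter> {..<v})"
      using that CB open_Int_closure_subset[of "{..<v}" B] by (auto simp: Int_commute)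
    then have "f x \<in> {..f v}"
      using lim[of "B \<inter> {..<v}" "{..f v}" x] fB_mono that by force
    then show ?thesis by simp
  qed simp
  have f_ge: "f u \<le> f x" if "x \<in> C" "u \<in> B" "u \<le> x" for x u
  proof (cases "x = u")
    case False
    then have "x \<in> closure (B \<inter> {u<..})"
      using that CB open_Int_closure_subset[of "{u<..}" B] by (auto simp: Int_commute)
    then have "f x \<in> {f u..}"
      using lim[of "B \<inter> {u<..}" "{f u..}" x] fB_mono that by force
    then show ?thesis by simp
  qed simp
  have mono: "strict_mono_on C f"
  proof (rule strict_mono_onI)
    fix x x' assume x: "x \<in> C" "x' \<in> C" "x < x'"
    then have e: "(x' - x)/2 > 0" by simp
    obtain u v where v: "u \<in> B" "v \<in> B" "u \<le> x" "x \<le> v" "v - u < (x' - x)/2" using C(4)[OF x(1) e] by blast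
    obtain u' v' where u': "u' \<in> B" "v' \<in> B" "u' \<le> x'" "x' \<le> v'" "v' - u' < (x' - x)/2"
      using C(4)[OF x(2) e] by blast
    have "v < u'" using v u' by argo
    then show "f x < f x'" using f_le[OF x(1) v(2,4)] f_ge[OF x(2) u'(1,3)] fB_mono[OF v(2) u'(1)] by linarith
  qed
  have contC: "continuous_on C f" using cont CB continuous_on_subset by blast
  have fC: "f ` C \<subseteq> K"
  proof
    fix y assume "y \<in> f ` C"
    then obtain x where x: "x \<in> C" "y = f x" by blast
    have "f ` B \<subseteq> K" unfolding B_def using fg TE ED(1) LK by force
    then show "y \<in> K" using lim[OF subset_refl clK] x CB by blast
  qed
  \<comment> \<open>an interval in \<open>C\<close> would be mapped onto a nondegenerate interval in \<open>K\<close>\<close>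
  have "interior C = {}"
  proof (rule ccontr)
    assume "interior C \<noteq> {}"
    then obtain s where "s \<in> interior C" by blast
    then obtain d where d: "d > 0" "cball s d \<subseteq> C" unfolding mem_interior_cball by blast
    then have st: "{s..s+d} \<subseteq> C" by (auto simp: subset_iff dist_real_def)
    have "connected (f ` {s..s+d})"
      using contC st by (intro connected_continuous_image) (auto intro: continuous_on_subset)
    moreover have "f s \<in> f ` {s..s+d}" "f (s+d) \<in> f ` {s..s+d}" using d(1) by auto
    ultimately have "{f s..f (s+d)} \<subseteq> f ` {s..s+d}" using connected_contains_Icc by blast
    also have "\<dots> \<subseteq> K" using st fC by (meson image_mono order_trans)
    finally have "{f s<..<f (s+d)} \<subseteq> K" using greaterThanLessThan_subseteq_atLeastAtMost_iff by blast
    then have "{f s<..<f (s+d)} \<subseteq> interior K" by (rule interior_maximal) simp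
    moreover have "f s < f (s+d)"
      by (rule strict_mono_onD[OF mono]) (use st d(1) in auto)
    ultimately have "interior K \<noteq> {}" using greaterThanLessThan_empty_iff[of "f s" "f (s+d)"] by auto
    then show False using K clK unfolding cantor_set_def nowhere_dense_def by simp
  qed
  then have "cantor_set C" using C(1-3) unfolding cantor_set_def perfect_def nowhere_dense_def by simp
  moreover have "C \<subseteq> {a<..<b}" using CB clB a1 b2 by force
  ultimately show thesis using that contC mono fC unfolding f_def by blast
qed

theorem theorem3p1:
  fixes f :: "real \<Rightarrow> real"
  assumes "extendable f"
    and "closure (graph_on UNIV f) = UNIV"
  shows "\<forall>a b. a < b \<longrightarrow>
    (\<forall>K. cantor_set K \<and> between_points K (f a) (f b) \<longrightarrow>
      (\<exists>C. cantor_set C \<and> between_points C a b \<and> f ` C \<subseteq> K \<and>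
        continuous_on C f \<and> strict_mono_on C f))"
proof (intro allI impI, elim conjE)
  fix a b :: real and K
  assume ab: "a < b" and K: "cantor_set K" and btw: "between_points K (f a) (f b)"
  obtain F :: "real \<times> real \<Rightarrow> real" where F: "connectivity_on (UNIV \<times> {0..1}) F" and fF: "\<And>x. f x = F (x, 0)"
    using assms(1) unfolding extendable_def by blast
  have dense: "\<exists>x. s < x \<and> x < t \<and> f x \<in> V" if "s < t" "open V" "V \<noteq> {}" for s t V
  proof -
    have "open ({s<..<t} \<times> V)" using that by (simp add: open_Times)
    moreover have "{s<..<t} \<times> V \<noteq> {}" using that dense[of s t] by auto
    ultimately have "{s<..<t} \<times> V \<inter> graph_on UNIV f \<noteq> {}"
      using assms(2) open_Int_closure_eq_empty[of "{s<..<t} \<times> V" "graph_on UNIV f"] by simp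
    then show ?thesis unfolding graph_on_def by auto
  qed
  define m where "m = (a + b)/2"
  have m: "a < m" "m < b" using ab unfolding m_def by auto
  \<comment> \<open>by density, points on which \<open>f\<close> lies below \<open>K\<close> and above \<open>K\<close>, in this order, whatever
    the order of \<open>f a\<close> and \<open>f b\<close>\<close>
  have "{..<min (f a) (f b)} \<noteq> {}" "{max (f a) (f b)<..} \<noteq> {}"
    using lt_ex[of "min (f a) (f b)"] gt_ex[of "max (f a) (f b)"] by auto
  then obtain a' b' where a': "a < a'" "a' < m" "f a' < min (f a) (f b)"
    and b': "m < b'" "b' < b" "max (f a) (f b) < f b'"
    using dense[OF m(1), of "{..<min (f a) (f b)}"] dense[OF m(2), of "{max (f a) (f b)<..}"] by auto
  have "K \<subseteq> {F (a', 0)<..<F (b', 0)}"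
    using btw a'(3) b'(3) unfolding between_points_def open_segment_eq_real_ivl fF[symmetric]
    by (auto split: if_splits)
  then obtain C where C: "cantor_set C" "C \<subseteq> {a'<..<b'}" "f ` C \<subseteq> K" "continuous_on C f" "strict_mono_on C f"
    using increasing_cantor_restriction[OF F _ K, of a' b'] a' b' unfolding fF[symmetric] by auto
  moreover have "between_points C a b"
    using C(2) a' b' ab unfolding between_points_def open_segment_eq_real_ivl by auto
  ultimately show "\<exists>C. cantor_set C \<and> between_points C a b \<and> f ` C \<subseteq> K \<and>
      continuous_on C f \<and> strict_mono_on C f" by blast
qed

end
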